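(* $\mathsf{HT}$ does not hold in the First Fraenkel Model $\mathcal N_1$.
   Context: The First Fraenkel Model $\mathcal N_1$ is the Fraenkel–Mostowski permutation model of $\mathsf{ZFA}$ built from a countably infinite set $A$ of atoms, the group of all permutations of $A$, and the normal filter of subgroups generated by pointwise stabilizers of finite subsets of $A$ (finite supports); it consists of the hereditarily symmetric sets. $[X]^{<\omega}$ is the set of finite subsets of $X$; for $Y\subseteq[X]^{<\omega}$, $\mathrm{FU}(Y)=\{\bigcup_{y\in F}y : F\subseteq Y\text{ finite nonempty}\}$. $\mathsf{HT}$: for every infinite set $X$ and every $c:[X]^{<\omega}\to 2$ there is an infinite pairwise disjoint $Y\subseteq[X]^{<\omega}$ with $\mathrm{FU}(Y)$ $c$-monochromatic. *)

theory Defs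
  imports Main
begin

section \<open>Structures for set theory with atoms\<close>

text \<open>
  Structures for the language of ZFA: a universe, a membership relation, and a constant for the
  set of all atoms.  Set-theoretic notions are defined over an arbitrary structure, and all their
  quantifiers range over its universe; so \<open>P S x\<close> says that \<open>S\<close> satisfies the formula defining \<open>P\<close>
  at \<open>x\<close>, and passing to a subuniverse relativizes the notion.
\<close>

record 'u zfa_structure =
  univ :: "'u set"
  mem :: "'u \<Rightarrow> 'u \<Rightarrow> bool" (infix "\<epsilon>\<index>" 50)
  atoms :: 'u

definition is_set :: "'u zfa_structure \<Rightarrow> 'u \<Rightarrow> bool" where
  "is_set S x \<longleftrightarrow> \<not> x \<epsilon>\<^bsub>S\<^esub> atoms S"

definition is_subset :: "'u zfa_structure \<Rightarrow> 'u \<Rightarrow> 'u \<Rightarrow> bool" where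
  "is_subset S x y \<longleftrightarrow>
     is_set S x \<and> is_set S y \<and> (\<forall>z\<in>univ S. z \<epsilon>\<^bsub>S\<^esub> x \<longrightarrow> z \<epsilon>\<^bsub>S\<^esub> y)"

definition is_empty :: "'u zfa_structure \<Rightarrow> 'u \<Rightarrow> bool" where
  "is_empty S x \<longleftrightarrow> is_set S x \<and> (\<forall>z\<in>univ S. \<not> z \<epsilon>\<^bsub>S\<^esub> x)"

definition disjoint_in :: "'u zfa_structure \<Rightarrow> 'u \<Rightarrow> 'u \<Rightarrow> bool" where
  "disjoint_in S x y \<longleftrightarrow> \<not> (\<exists>z\<in>univ S. z \<epsilon>\<^bsub>S\<^esub> x \<and> z \<epsilon>\<^bsub>S\<^esub> y)"

definition is_union :: "'u zfa_structure \<Rightarrow> 'u \<Rightarrow> 'u \<Rightarrow> bool" where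
  "is_union S x u \<longleftrightarrow>
     is_set S u \<and> (\<forall>z\<in>univ S. z \<epsilon>\<^bsub>S\<^esub> u \<longleftrightarrow> (\<exists>y\<in>univ S. y \<epsilon>\<^bsub>S\<^esub> x \<and> z \<epsilon>\<^bsub>S\<^esub> y))"

text \<open>\<open>p = {x, y}\<close>, and the Kuratowski pair \<open>p = (x, y) = {{x}, {x, y}}\<close>.\<close>

definition is_upair :: "'u zfa_structure \<Rightarrow> 'u \<Rightarrow> 'u \<Rightarrow> 'u \<Rightarrow> bool" where
  "is_upair S x y p \<longleftrightarrow> (\<forall>z\<in>univ S. z \<epsilon>\<^bsub>S\<^esub> p \<longleftrightarrow> z = x \<or> z = y)"

definition is_opair :: "'u zfa_structure \<Rightarrow> 'u \<Rightarrow> 'u \<Rightarrow> 'u \<Rightarrow> bool" where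
  "is_opair S x y p \<longleftrightarrow>
     (\<exists>u\<in>univ S. \<exists>v\<in>univ S. is_upair S x x u \<and> is_upair S x y v \<and> is_upair S u v p)"

text \<open>\<open>(a, b) \<in> f\<close>, i.e. \<open>f(a) = b\<close> when \<open>f\<close> is a function.\<close>

definition maps_to :: "'u zfa_structure \<Rightarrow> 'u \<Rightarrow> 'u \<Rightarrow> 'u \<Rightarrow> bool" where
  "maps_to S f a b \<longleftrightarrow> (\<exists>p\<in>univ S. is_opair S a b p \<and> p \<epsilon>\<^bsub>S\<^esub> f)"

definition is_function :: "'u zfa_structure \<Rightarrow> 'u \<Rightarrow> 'u \<Rightarrow> 'u \<Rightarrow> bool" where
  "is_function S f x y \<longleftrightarrow>
     is_set S f \<and>
     (\<forall>p\<in>univ S. p \<epsilon>\<^bsub>S\<^esub> f \<longrightarrow>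
        (\<exists>a\<in>univ S. \<exists>b\<in>univ S. a \<epsilon>\<^bsub>S\<^esub> x \<and> b \<epsilon>\<^bsub>S\<^esub> y \<and> is_opair S a b p)) \<and>
     (\<forall>a\<in>univ S. a \<epsilon>\<^bsub>S\<^esub> x \<longrightarrow> (\<exists>!b. b \<in> univ S \<and> maps_to S f a b))"

definition is_bijection :: "'u zfa_structure \<Rightarrow> 'u \<Rightarrow> 'u \<Rightarrow> 'u \<Rightarrow> bool" where
  "is_bijection S f x y \<longleftrightarrow>
     is_function S f x y \<and>
     (\<forall>b\<in>univ S. b \<epsilon>\<^bsub>S\<^esub> y \<longrightarrow> (\<exists>!a. a \<in> univ S \<and> maps_to S f a b))"

definition is_transitive :: "'u zfa_structure \<Rightarrow> 'u \<Rightarrow> bool" where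
  "is_transitive S x \<longleftrightarrow>
     is_set S x \<and> (\<forall>y\<in>univ S. \<forall>z\<in>univ S. y \<epsilon>\<^bsub>S\<^esub> x \<longrightarrow> z \<epsilon>\<^bsub>S\<^esub> y \<longrightarrow> z \<epsilon>\<^bsub>S\<^esub> x)"

text \<open>\<open>s = x \<union> {x}\<close>.\<close>

definition is_succ :: "'u zfa_structure \<Rightarrow> 'u \<Rightarrow> 'u \<Rightarrow> bool" where
  "is_succ S x s \<longleftrightarrow> (\<forall>z\<in>univ S. z \<epsilon>\<^bsub>S\<^esub> s \<longleftrightarrow> z \<epsilon>\<^bsub>S\<^esub> x \<or> z = x)"

text \<open>
  Von Neumann ordinals as transitive sets of transitive sets (this relies on foundation; as atoms
  are not sets, ordinals have no atoms as elements).  A natural number is an ordinal such that it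
  and all its elements are zero or a successor.
\<close>

definition is_ordinal :: "'u zfa_structure \<Rightarrow> 'u \<Rightarrow> bool" where
  "is_ordinal S n \<longleftrightarrow>
     is_transitive S n \<and> (\<forall>m\<in>univ S. m \<epsilon>\<^bsub>S\<^esub> n \<longrightarrow> is_transitive S m)"

definition is_natural :: "'u zfa_structure \<Rightarrow> 'u \<Rightarrow> bool" where
  "is_natural S n \<longleftrightarrow>
     is_ordinal S n \<and>
     (\<forall>m\<in>univ S. m \<epsilon>\<^bsub>S\<^esub> n \<or> m = n \<longrightarrow> is_empty S m \<or> (\<exists>k\<in>univ S. is_succ S k m))"

definition is_omega :: "'u zfa_structure \<Rightarrow> 'u \<Rightarrow> bool" where
  "is_omega S w \<longleftrightarrow> is_set S w \<and> (\<forall>n\<in>univ S. n \<epsilon>\<^bsub>S\<^esub> w \<longleftrightarrow> is_natural S n)"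

definition is_finite :: "'u zfa_structure \<Rightarrow> 'u \<Rightarrow> bool" where
  "is_finite S x \<longleftrightarrow>
     is_set S x \<and> (\<exists>n\<in>univ S. \<exists>f\<in>univ S. is_natural S n \<and> is_bijection S f x n)"

definition is_infinite :: "'u zfa_structure \<Rightarrow> 'u \<Rightarrow> bool" where
  "is_infinite S x \<longleftrightarrow> is_set S x \<and> \<not> is_finite S x"

definition is_countably_infinite :: "'u zfa_structure \<Rightarrow> 'u \<Rightarrow> bool" where
  "is_countably_infinite S x \<longleftrightarrow>
     is_set S x \<and> (\<exists>w\<in>univ S. \<exists>f\<in>univ S. is_omega S w \<and> is_bijection S f x w)"


section \<open>The statement HT\<close>

text \<open>\<open>P = [X]\<^sup><\<^sup>\<omega>\<close>.\<close>

definition is_fin_subsets :: "'u zfa_structure \<Rightarrow> 'u \<Rightarrow> 'u \<Rightarrow> bool" where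
  "is_fin_subsets S X P \<longleftrightarrow>
     is_set S P \<and> (\<forall>y\<in>univ S. y \<epsilon>\<^bsub>S\<^esub> P \<longleftrightarrow> is_subset S y X \<and> is_finite S y)"

text \<open>\<open>z \<in> FU(Y)\<close>.\<close>

definition in_FU :: "'u zfa_structure \<Rightarrow> 'u \<Rightarrow> 'u \<Rightarrow> bool" where
  "in_FU S Y z \<longleftrightarrow>
     (\<exists>F\<in>univ S. is_subset S F Y \<and> is_finite S F \<and> (\<exists>y\<in>univ S. y \<epsilon>\<^bsub>S\<^esub> F) \<and> is_union S F z)"

text \<open>\<open>t = 2 = {0, {0}}\<close>.\<close>

definition is_two :: "'u zfa_structure \<Rightarrow> 'u \<Rightarrow> bool" where
  "is_two S t \<longleftrightarrow>
     (\<exists>z\<in>univ S. \<exists>u\<in>univ S. is_empty S z \<and> is_upair S z z u \<and> is_upair S z u t)"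

definition HT :: "'u zfa_structure \<Rightarrow> bool" where
  "HT S \<longleftrightarrow>
     (\<forall>X\<in>univ S. \<forall>P\<in>univ S. \<forall>t\<in>univ S. \<forall>c\<in>univ S.
        is_infinite S X \<and> is_fin_subsets S X P \<and> is_two S t \<and> is_function S c P t \<longrightarrow>
        (\<exists>Y\<in>univ S.
           is_subset S Y P \<and> is_infinite S Y \<and>
           (\<forall>y\<in>univ S. \<forall>y'\<in>univ S. y \<epsilon>\<^bsub>S\<^esub> Y \<and> y' \<epsilon>\<^bsub>S\<^esub> Y \<and> y \<noteq> y' \<longrightarrow> disjoint_in S y y') \<and>
           (\<exists>i\<in>univ S. i \<epsilon>\<^bsub>S\<^esub> t \<and> (\<forall>z\<in>univ S. in_FU S Y z \<longrightarrow> maps_to S c z i))))"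


section \<open>Models of ZFA with choice\<close>

text \<open>
  First-order formulas, with de Bruijn indices, for the separation and replacement schemas.
  The valuation supplies the parameters; the set of atoms may be used as a parameter.
\<close>

datatype fm = Mem nat nat | Eq nat nat | Neg fm | Conj fm fm | All fm

primrec sat :: "'u zfa_structure \<Rightarrow> (nat \<Rightarrow> 'u) \<Rightarrow> fm \<Rightarrow> bool" where
  "sat S e (Mem i j) \<longleftrightarrow> e i \<epsilon>\<^bsub>S\<^esub> e j"
| "sat S e (Eq i j) \<longleftrightarrow> e i = e j"
| "sat S e (Neg \<phi>) \<longleftrightarrow> \<not> sat S e \<phi>"
| "sat S e (Conj \<phi> \<psi>) \<longleftrightarrow> sat S e \<phi> \<and> sat S e \<psi>"
| "sat S e (All \<phi>) \<longleftrightarrow> (\<forall>x\<in>univ S. sat S (case_nat x e) \<phi>)"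

locale zfac_model =
  fixes V :: "'u zfa_structure"
  assumes atoms_in_univ: "atoms V \<in> univ V"
    and atoms_no_elements:
      "\<forall>a\<in>univ V. \<forall>x\<in>univ V. a \<epsilon>\<^bsub>V\<^esub> atoms V \<longrightarrow> \<not> x \<epsilon>\<^bsub>V\<^esub> a"
    and extensionality:
      "\<forall>x\<in>univ V. \<forall>y\<in>univ V. is_set V x \<and> is_set V y \<and>
         (\<forall>z\<in>univ V. z \<epsilon>\<^bsub>V\<^esub> x \<longleftrightarrow> z \<epsilon>\<^bsub>V\<^esub> y) \<longrightarrow> x = y"
    and foundation:
      "\<forall>x\<in>univ V. (\<exists>y\<in>univ V. y \<epsilon>\<^bsub>V\<^esub> x) \<longrightarrow> (\<exists>y\<in>univ V. y \<epsilon>\<^bsub>V\<^esub> x \<and> disjoint_in V y x)"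
    and empty_set: "\<exists>x\<in>univ V. is_empty V x"
    and pairing: "\<forall>x\<in>univ V. \<forall>y\<in>univ V. \<exists>p\<in>univ V. is_upair V x y p"
    and union: "\<forall>x\<in>univ V. \<exists>u\<in>univ V. is_union V x u"
    and power_set:
      "\<forall>x\<in>univ V. is_set V x \<longrightarrow> (\<exists>p\<in>univ V. \<forall>y\<in>univ V. y \<epsilon>\<^bsub>V\<^esub> p \<longleftrightarrow> is_subset V y x)"
    and infinity:
      "\<exists>w\<in>univ V. (\<exists>z\<in>univ V. is_empty V z \<and> z \<epsilon>\<^bsub>V\<^esub> w) \<and>
         (\<forall>x\<in>univ V. x \<epsilon>\<^bsub>V\<^esub> w \<longrightarrow> (\<exists>s\<in>univ V. is_succ V x s \<and> s \<epsilon>\<^bsub>V\<^esub> w))"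
    and separation:
      "\<forall>\<phi> e. range e \<subseteq> univ V \<longrightarrow>
         (\<forall>x\<in>univ V. \<exists>z\<in>univ V. is_set V z \<and>
            (\<forall>y\<in>univ V. y \<epsilon>\<^bsub>V\<^esub> z \<longleftrightarrow> y \<epsilon>\<^bsub>V\<^esub> x \<and> sat V (case_nat y e) \<phi>))"
    and replacement:
      "\<forall>\<phi> e. range e \<subseteq> univ V \<longrightarrow>
         (\<forall>x\<in>univ V.
            (\<forall>y\<in>univ V. \<forall>z\<in>univ V. \<forall>z'\<in>univ V. y \<epsilon>\<^bsub>V\<^esub> x \<and>
               sat V (case_nat y (case_nat z e)) \<phi> \<and> sat V (case_nat y (case_nat z' e)) \<phi> \<longrightarrow>
               z = z') \<longrightarrow>
            (\<exists>w\<in>univ V. is_set V w \<and>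
               (\<forall>z\<in>univ V. z \<epsilon>\<^bsub>V\<^esub> w \<longleftrightarrow>
                  (\<exists>y\<in>univ V. y \<epsilon>\<^bsub>V\<^esub> x \<and> sat V (case_nat y (case_nat z e)) \<phi>))))"
    and choice:
      "\<forall>x\<in>univ V.
         (\<forall>y\<in>univ V. y \<epsilon>\<^bsub>V\<^esub> x \<longrightarrow> (\<exists>z\<in>univ V. z \<epsilon>\<^bsub>V\<^esub> y)) \<and>
         (\<forall>y\<in>univ V. \<forall>y'\<in>univ V. y \<epsilon>\<^bsub>V\<^esub> x \<and> y' \<epsilon>\<^bsub>V\<^esub> x \<and> y \<noteq> y' \<longrightarrow> disjoint_in V y y') \<longrightarrow>
         (\<exists>C\<in>univ V. \<forall>y\<in>univ V. y \<epsilon>\<^bsub>V\<^esub> x \<longrightarrow>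
            (\<exists>!z. z \<in> univ V \<and> z \<epsilon>\<^bsub>V\<^esub> y \<and> z \<epsilon>\<^bsub>V\<^esub> C))"


section \<open>The First Fraenkel Model\<close>

definition atom_perms :: "'u zfa_structure \<Rightarrow> 'u set" where
  "atom_perms V = {\<pi> \<in> univ V. is_bijection V \<pi> (atoms V) (atoms V)}"

text \<open>
  The action of a permutation \<open>\<pi>\<close> of the atoms is given by membership recursion:
  \<open>\<pi>\<close> is applied to atoms, and \<open>\<pi> x = {\<pi> u | u \<in> x}\<close> for sets \<open>x\<close>.  As usual, the recursion is
  witnessed by a function \<open>f\<close> on a transitive set \<open>t\<close> satisfying the recursion equations;
  \<open>perm_image V \<pi> x y\<close> says \<open>\<pi> x = y\<close>.
\<close>

definition extends_perm :: "'u zfa_structure \<Rightarrow> 'u \<Rightarrow> 'u \<Rightarrow> 'u \<Rightarrow> bool" where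
  "extends_perm V \<pi> t f \<longleftrightarrow>
     (\<exists>r\<in>univ V. is_function V f t r) \<and>
     (\<forall>x\<in>univ V. \<forall>y\<in>univ V. x \<epsilon>\<^bsub>V\<^esub> t \<and> maps_to V f x y \<longrightarrow>
        (if x \<epsilon>\<^bsub>V\<^esub> atoms V then maps_to V \<pi> x y
         else is_set V y \<and>
           (\<forall>v\<in>univ V. v \<epsilon>\<^bsub>V\<^esub> y \<longleftrightarrow> (\<exists>u\<in>univ V. u \<epsilon>\<^bsub>V\<^esub> x \<and> maps_to V f u v))))"

definition perm_image :: "'u zfa_structure \<Rightarrow> 'u \<Rightarrow> 'u \<Rightarrow> 'u \<Rightarrow> bool" where
  "perm_image V \<pi> x y \<longleftrightarrow>
     (\<exists>t\<in>univ V. \<exists>f\<in>univ V.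
        is_transitive V t \<and> x \<epsilon>\<^bsub>V\<^esub> t \<and> extends_perm V \<pi> t f \<and> maps_to V f x y)"

definition stabilizer :: "'u zfa_structure \<Rightarrow> 'u \<Rightarrow> 'u set" where
  "stabilizer V x = {\<pi> \<in> atom_perms V. perm_image V \<pi> x x}"

definition pointwise_stabilizer :: "'u zfa_structure \<Rightarrow> 'u \<Rightarrow> 'u set" where
  "pointwise_stabilizer V E =
     {\<pi> \<in> atom_perms V. \<forall>a\<in>univ V. a \<epsilon>\<^bsub>V\<^esub> E \<longrightarrow> maps_to V \<pi> a a}"

text \<open>
  Finite intersections of pointwise stabilizers of finite sets of atoms are again of this form, so
  a subgroup belongs to the filter they generate iff it includes one of them.  Hence \<open>x\<close> is
  symmetric, i.e. its stabilizer is in the filter, iff \<open>x\<close> has a finite support \<open>E\<close>.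
\<close>

definition is_symmetric :: "'u zfa_structure \<Rightarrow> 'u \<Rightarrow> bool" where
  "is_symmetric V x \<longleftrightarrow>
     (\<exists>E\<in>univ V. is_subset V E (atoms V) \<and> is_finite V E \<and>
        pointwise_stabilizer V E \<subseteq> stabilizer V x)"

text \<open>\<open>z\<close> is in the transitive closure of \<open>{x}\<close>, the least transitive set with element \<open>x\<close>.\<close>

definition in_trans_closure :: "'u zfa_structure \<Rightarrow> 'u \<Rightarrow> 'u \<Rightarrow> bool" where
  "in_trans_closure V x z \<longleftrightarrow>
     (\<forall>t\<in>univ V. is_transitive V t \<and> x \<epsilon>\<^bsub>V\<^esub> t \<longrightarrow> z \<epsilon>\<^bsub>V\<^esub> t)"

definition hereditarily_symmetric :: "'u zfa_structure \<Rightarrow> 'u \<Rightarrow> bool" where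
  "hereditarily_symmetric V x \<longleftrightarrow>
     (\<forall>z\<in>univ V. in_trans_closure V x z \<longrightarrow> is_symmetric V z)"

definition first_fraenkel_model :: "'u zfa_structure \<Rightarrow> 'u zfa_structure" where
  "first_fraenkel_model V = V\<lparr>univ := {x \<in> univ V. hereditarily_symmetric V x}\<rparr>"

end

theory Submission
  imports Defs
begin

text \<open>
  Colour a finite set of atoms according to whether it is a singleton.  This colouring is fixed by
  all permutations of the atoms, so it lies in the model.  An infinite pairwise disjoint family \<open>Y\<close>
  of finite sets of atoms has a finite support \<open>E\<close>, and some \<open>y \<in> Y\<close> has an element \<open>a \<notin> E\<close>.
  For an atom \<open>d\<close> outside \<open>E\<close> and \<open>y\<close>, the transposition of \<open>a\<close> and \<open>d\<close> maps \<open>y\<close> to another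
  element of \<open>Y\<close>; as the two are disjoint, \<open>y = {a}\<close> and its image is \<open>{d}\<close>.  So \<open>FU(Y)\<close> contains
  both \<open>{a}\<close> and \<open>{a, d}\<close>, which have different colours.

  The natural numbers of \<open>V\<close> may be nonstandard, so finiteness is not finiteness in the metatheory:
  every induction is carried out inside \<open>V\<close>, by separation applied to an explicit formula.
\<close>

text \<open>Two obstacles shape the proof. Membership in the model refers to
  \<open>perm_image\<close>, a membership recursion in \<open>V\<close>. For a set whose hereditary
  atoms all lie in a finite \<open>E\<close> the identity solves this recursion. But the set of
  atoms, the set \<open>P\<close> of its finite subsets and the colouring involve all atoms, so
  there the action of \<open>\<pi>\<close> must be constructed. As they lie a fixed number of
  power-set steps above the atoms, it is built step by step, each step by one formula in the
  previous one. Separation accepts formulas only, so the action is kept twice: as a metatheoretic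
  map \<open>H\<close> and as a function \<open>h\<close> in \<open>V\<close>. The second obstacle
  is that finiteness in the model asks for a bijection in the model, and \<open>Y\<close> is
  infinite only in that sense. To see that some \<open>y \<in> Y\<close> leaves the support
  \<open>E\<close>, a disjoint family of subsets of \<open>E\<close> must be shown finite in the
  model: it is finite in \<open>V\<close>, and a bijection with a number again involves only atoms
  of \<open>E\<close>. Countability of the atoms enters through \<open>fresh_atom\<close>, which
  yields \<open>d\<close> and also the infinity of the set of atoms.\<close>

definition elts :: "'u zfa_structure \<Rightarrow> 'u \<Rightarrow> 'u set" where
  "elts S x = {z \<in> univ S. z \<epsilon>\<^bsub>S\<^esub> x}"

lemma elts_subset_univ: "elts S x \<subseteq> univ S"
  by (auto simp: elts_def)

lemma elts_univD: "z \<in> elts S x \<Longrightarrow> z \<in> univ S"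
  by (auto simp: elts_def)

lemma mem_elts_iff: "z \<in> univ S \<Longrightarrow> z \<epsilon>\<^bsub>S\<^esub> x \<longleftrightarrow> z \<in> elts S x"
  by (auto simp: elts_def)

lemma is_set_elts_iff: "x \<in> univ S \<Longrightarrow> is_set S x \<longleftrightarrow> x \<notin> elts S (atoms S)"
  by (auto simp: elts_def is_set_def)

lemma is_subset_iff: "is_subset S x y \<longleftrightarrow> is_set S x \<and> is_set S y \<and> elts S x \<subseteq> elts S y"
  by (auto simp: elts_def is_subset_def)

lemma is_empty_iff: "is_empty S x \<longleftrightarrow> is_set S x \<and> elts S x = {}"
  by (auto simp: elts_def is_empty_def)

lemma disjoint_in_iff: "disjoint_in S x y \<longleftrightarrow> elts S x \<inter> elts S y = {}"
  by (auto simp: elts_def disjoint_in_def)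

lemma is_union_iff: "is_union S x u \<longleftrightarrow> is_set S u \<and> elts S u = (\<Union>y\<in>elts S x. elts S y)"
  unfolding is_union_def elts_def by (rule conj_cong[OF refl]) blast

lemma is_upair_iff:
  "x \<in> univ S \<Longrightarrow> y \<in> univ S \<Longrightarrow> is_upair S x y p \<longleftrightarrow> elts S p = {x, y}"
  by (auto simp: elts_def is_upair_def)

lemma is_succ_iff: "x \<in> univ S \<Longrightarrow> is_succ S x s \<longleftrightarrow> elts S s = insert x (elts S x)"
  by (auto simp: elts_def is_succ_def)

lemma is_transitive_iff:
  "is_transitive S x \<longleftrightarrow> is_set S x \<and> (\<forall>y\<in>elts S x. elts S y \<subseteq> elts S x)"
  by (auto simp: elts_def is_transitive_def)

lemma is_opair_iff:
  "a \<in> univ S \<Longrightarrow> b \<in> univ S \<Longrightarrow> is_opair S a b p \<longleftrightarrow>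
    (\<exists>u\<in>univ S. \<exists>v\<in>univ S. elts S u = {a} \<and> elts S v = {a, b} \<and> elts S p = {u, v})"
  by (auto simp: is_opair_def is_upair_iff)

lemma maps_to_iff: "maps_to S f a b \<longleftrightarrow> (\<exists>p\<in>elts S f. is_opair S a b p)"
  by (auto simp: maps_to_def elts_def)

lemma is_function_iff:
  "is_function S f x y \<longleftrightarrow> is_set S f \<and>
     (\<forall>p\<in>elts S f. \<exists>a\<in>elts S x. \<exists>b\<in>elts S y. is_opair S a b p) \<and>
     (\<forall>a\<in>elts S x. \<exists>!b. b \<in> univ S \<and> maps_to S f a b)"
proof -
  have 1: "(\<forall>z\<in>univ S. z \<epsilon>\<^bsub>S\<^esub> u \<longrightarrow> P z) \<longleftrightarrow> (\<forall>z\<in>elts S u. P z)" for u P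
    by (auto simp: elts_def)
  have 2: "(\<exists>a\<in>univ S. \<exists>b\<in>univ S. a \<epsilon>\<^bsub>S\<^esub> x \<and> b \<epsilon>\<^bsub>S\<^esub> y \<and> P a b) \<longleftrightarrow> (\<exists>a\<in>elts S x. \<exists>b\<in>elts S y. P a b)" for P
    by (auto simp: elts_def)
  show ?thesis unfolding is_function_def 1 2 ..
qed

lemma is_bijection_iff:
  "is_bijection S f x y \<longleftrightarrow> is_function S f x y \<and>
     (\<forall>b\<in>elts S y. \<exists>!a. a \<in> univ S \<and> maps_to S f a b)"
  unfolding is_bijection_def elts_def by blast

lemma is_natural_iff:
  "n \<in> univ S \<Longrightarrow> is_natural S n \<longleftrightarrow> is_transitive S n \<and> (\<forall>m\<in>elts S n. is_transitive S m) \<and>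
     (\<forall>m\<in>insert n (elts S n). is_empty S m \<or> (\<exists>k\<in>univ S. is_succ S k m))"
  unfolding is_natural_def is_ordinal_def elts_def by auto

section \<open>Pairs and functions over an arbitrary structure\<close>

lemma opair_inject:
  assumes "is_opair S a b p" "is_opair S a' b' p" "a \<in> univ S" "b \<in> univ S" "a' \<in> univ S" "b' \<in> univ S"
  shows "a = a' \<and> b = b'"
proof -
  obtain u v where 1: "elts S u = {a}" "elts S v = {a, b}" "elts S p = {u, v}"
    using assms by (auto simp: is_opair_iff)
  obtain u' v' where 2: "elts S u' = {a'}" "elts S v' = {a', b'}" "elts S p = {u', v'}"
    using assms by (auto simp: is_opair_iff)
  have "(u = u' \<and> v = v') \<or> (u = v' \<and> v = u')"
    using 1(3) 2(3) by (auto simp: doubleton_eq_iff)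
  then show ?thesis
    using 1(1,2) 2(1,2) by (auto simp: doubleton_eq_iff)
qed

lemma function_maps_toD:
  assumes "is_function S f x y" "maps_to S f a b" "a \<in> univ S" "b \<in> univ S"
  shows "a \<in> elts S x" "b \<in> elts S y"
proof -
  obtain p where p: "p \<in> elts S f" "is_opair S a b p" using assms by (auto simp: maps_to_iff)
  then obtain a' b' where ab: "a' \<in> elts S x" "b' \<in> elts S y" "is_opair S a' b' p"
    using assms(1) unfolding is_function_iff by blast
  then have "a' = a \<and> b' = b"
    using opair_inject[OF ab(3) p(2)] assms by (auto dest: elts_univD)
  then show "a \<in> elts S x" "b \<in> elts S y" using ab by auto
qed

lemma function_unique:
  assumes "is_function S f x y" "maps_to S f a b" "maps_to S f a b'" "a \<in> univ S" "b \<in> univ S" "b' \<in> univ S"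
  shows "b = b'"
  using function_maps_toD[OF assms(1,2,4,5)] assms unfolding is_function_iff by blast

lemma function_total:
  assumes "is_function S f x y" "a \<in> elts S x"
  obtains b where "b \<in> elts S y" "maps_to S f a b"
  using assms function_maps_toD[OF assms(1)] elts_univD[OF assms(2)] unfolding is_function_iff by blast

lemma bijection_is_function: "is_bijection S f x y \<Longrightarrow> is_function S f x y"
  by (simp add: is_bijection_iff)

lemma bijection_onto:
  assumes "is_bijection S f x y" "b \<in> elts S y"
  obtains a where "a \<in> elts S x" "maps_to S f a b"
  using assms function_maps_toD[OF bijection_is_function[OF assms(1)]] elts_univD[OF assms(2)]
  unfolding is_bijection_iff by blast

lemma bijection_inject:
  assumes "is_bijection S f x y" "maps_to S f a b" "maps_to S f a' b" "a \<in> univ S" "a' \<in> univ S" "b \<in> univ S"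
  shows "a = a'"
  using function_maps_toD[OF bijection_is_function[OF assms(1)] assms(2,4,6)] assms
  unfolding is_bijection_iff by blast

context zfac_model
begin

section \<open>Definability\<close>

text \<open>
  \<open>definable k l P\<close>: a formula expresses \<open>P\<close> on all valuations that carry the parameters
  \<open>atoms V # l\<close> from position \<open>k\<close> on.  A quantifier shifts the valuation, which raises \<open>k\<close> by one.
\<close>

definition env :: "nat \<Rightarrow> 'u list \<Rightarrow> (nat \<Rightarrow> 'u) \<Rightarrow> bool" where
  "env k l e \<longleftrightarrow> range e \<subseteq> univ V \<and> (\<forall>i<Suc (length l). e (k + i) = (atoms V # l) ! i)"

definition definable :: "nat \<Rightarrow> 'u list \<Rightarrow> ((nat \<Rightarrow> 'u) \<Rightarrow> bool) \<Rightarrow> bool" where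
  "definable k l P \<longleftrightarrow> (\<exists>\<phi>. \<forall>e. env k l e \<longrightarrow> (sat V e \<phi> \<longleftrightarrow> P e))"

text \<open>The language has no function symbols, so a term is just a position of the valuation.
  Constants count as terms because \<open>env\<close> stores them at fixed positions; the closure
  rules can thus treat \<open>atoms V\<close>, parameters and bound variables alike.\<close>

definition is_term :: "nat \<Rightarrow> 'u list \<Rightarrow> ((nat \<Rightarrow> 'u) \<Rightarrow> 'u) \<Rightarrow> bool" where
  "is_term k l t \<longleftrightarrow> (\<exists>j. \<forall>e. env k l e \<longrightarrow> t e = e j)"

lemma env_Suc: "env k l e \<Longrightarrow> x \<in> univ V \<Longrightarrow> env (Suc k) l (case_nat x e)"
  by (auto simp: env_def image_subset_iff split: nat.splits)

lemma term_var: "is_term k l (\<lambda>e. e j)"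
  by (auto simp: is_term_def)

lemma term_atoms: "is_term k l (\<lambda>e. atoms V)"
  unfolding is_term_def env_def by (intro exI[of _ k]) force

lemma term_param:
  assumes "c \<in> set l"
  shows "is_term k l (\<lambda>e. c)"
proof -
  obtain i where i: "i < length l" "l ! i = c" using assms by (auto simp: in_set_conv_nth)
  have "c = e (k + Suc i)" if "env k l e" for e
    using that i unfolding env_def by (metis Suc_mono nth_Cons_Suc)
  then show ?thesis unfolding is_term_def by blast
qed

lemma definable_mem:
  assumes "is_term k l s" "is_term k l t"
  shows "definable k l (\<lambda>e. s e \<epsilon>\<^bsub>V\<^esub> t e)"
proof -
  obtain i j where "\<forall>e. env k l e \<longrightarrow> s e = e i" "\<forall>e. env k l e \<longrightarrow> t e = e j"
    using assms by (auto simp: is_term_def)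
  then show ?thesis unfolding definable_def by (intro exI[of _ "Mem i j"]) auto
qed

lemma definable_eq:
  assumes "is_term k l s" "is_term k l t"
  shows "definable k l (\<lambda>e. s e = t e)"
proof -
  obtain i j where "\<forall>e. env k l e \<longrightarrow> s e = e i" "\<forall>e. env k l e \<longrightarrow> t e = e j"
    using assms by (auto simp: is_term_def)
  then show ?thesis unfolding definable_def by (intro exI[of _ "Eq i j"]) auto
qed

lemma definable_not:
  assumes "definable k l P"
  shows "definable k l (\<lambda>e. \<not> P e)"
proof -
  obtain \<phi> where "\<forall>e. env k l e \<longrightarrow> (sat V e \<phi> \<longleftrightarrow> P e)"
    using assms unfolding definable_def by blast
  then show ?thesis unfolding definable_def by (intro exI[of _ "Neg \<phi>"]) simp
qed

lemma definable_conj: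
  assumes "definable k l P" "definable k l Q"
  shows "definable k l (\<lambda>e. P e \<and> Q e)"
proof -
  obtain \<phi> \<psi> where "\<forall>e. env k l e \<longrightarrow> (sat V e \<phi> \<longleftrightarrow> P e)" "\<forall>e. env k l e \<longrightarrow> (sat V e \<psi> \<longleftrightarrow> Q e)"
    using assms unfolding definable_def by blast
  then show ?thesis unfolding definable_def by (intro exI[of _ "Conj \<phi> \<psi>"]) simp
qed

lemma definable_disj:
  assumes "definable k l P" "definable k l Q"
  shows "definable k l (\<lambda>e. P e \<or> Q e)"
  using definable_not[OF definable_conj[OF assms[THEN definable_not]]] by simp

lemma definable_imp:
  assumes "definable k l P" "definable k l Q"
  shows "definable k l (\<lambda>e. P e \<longrightarrow> Q e)"
  unfolding imp_conv_disj by (intro definable_disj definable_not assms)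

lemma definable_iff:
  assumes "definable k l P" "definable k l Q"
  shows "definable k l (\<lambda>e. P e \<longleftrightarrow> Q e)"
  unfolding iff_conv_conj_imp by (intro definable_conj definable_imp assms)

text \<open>The form \<open>Q (e 0) (\<lambda>n. e (Suc n))\<close> performs the de Bruijn shift by
  unification: after \<open>intro\<close> the bound variable is at position 0 and every outer
  position is raised by one, which matches \<open>case_nat x e\<close> in
  \<open>sat\<close>.\<close>

lemma definable_all:
  assumes "definable (Suc k) l (\<lambda>e. Q (e 0) (\<lambda>n. e (Suc n)))"
  shows "definable k l (\<lambda>e. \<forall>x\<in>univ V. Q x e)"
proof -
  obtain \<phi> where \<phi>: "\<forall>e. env (Suc k) l e \<longrightarrow> (sat V e \<phi> \<longleftrightarrow> Q (e 0) (\<lambda>n. e (Suc n)))"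
    using assms unfolding definable_def by blast
  have "sat V e (All \<phi>) \<longleftrightarrow> (\<forall>x\<in>univ V. Q x e)" if "env k l e" for e
    using \<phi>[rule_format, OF env_Suc[OF that]] by simp
  then show ?thesis unfolding definable_def by blast
qed

lemma definable_ex:
  assumes "definable (Suc k) l (\<lambda>e. Q (e 0) (\<lambda>n. e (Suc n)))"
  shows "definable k l (\<lambda>e. \<exists>x\<in>univ V. Q x e)"
  using definable_not[OF definable_all[of k l "\<lambda>x e. \<not> Q x e", OF definable_not[OF assms]]] by simp

lemma definable_ex1:
  assumes "definable k l (\<lambda>e. \<exists>x\<in>univ V. Q x e \<and> (\<forall>y\<in>univ V. Q y e \<longrightarrow> y = x))"
  shows "definable k l (\<lambda>e. \<exists>!x. x \<in> univ V \<and> Q x e)"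
proof -
  have "(\<lambda>e. \<exists>x\<in>univ V. Q x e \<and> (\<forall>y\<in>univ V. Q y e \<longrightarrow> y = x)) = (\<lambda>e. \<exists>!x. x \<in> univ V \<and> Q x e)"
    by (intro ext) blast
  then show ?thesis using assms by simp
qed

lemma definable_cong:
  "definable k l P \<Longrightarrow> (\<And>e. env k l e \<Longrightarrow> P e = Q e) \<Longrightarrow> definable k l Q"
  unfolding definable_def by blast

text \<open>Unfolding a notion puts its arguments under quantifiers, where an unspecified term
  \<open>s\<close> would turn into \<open>s (\<lambda>n. e (Suc n))\<close>, which no closure rule
  recognises. Variables \<open>e i\<close> shift to \<open>e (Suc i)\<close>, so the notion is
  unfolded for variables and terms are put in afterwards.\<close>

lemma definable_subst1:
  assumes "\<And>i. definable k l (\<lambda>e. Q (e i))" "is_term k l s"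
  shows "definable k l (\<lambda>e. Q (s e))"
proof -
  obtain i where "\<forall>e. env k l e \<longrightarrow> s e = e i" using assms by (auto simp: is_term_def)
  then show ?thesis by (intro definable_cong[OF assms(1)[of i]]) auto
qed

lemma definable_subst2:
  assumes "\<And>i j. definable k l (\<lambda>e. Q (e i) (e j))" "is_term k l s" "is_term k l t"
  shows "definable k l (\<lambda>e. Q (s e) (t e))"
proof -
  obtain i j where "\<forall>e. env k l e \<longrightarrow> s e = e i" "\<forall>e. env k l e \<longrightarrow> t e = e j"
    using assms by (auto simp: is_term_def)
  then show ?thesis by (intro definable_cong[OF assms(1)[of i j]]) auto
qed

lemma definable_subst3:
  assumes "\<And>i j m. definable k l (\<lambda>e. Q (e i) (e j) (e m))" "is_term k l s" "is_term k l t" "is_term k l u"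
  shows "definable k l (\<lambda>e. Q (s e) (t e) (u e))"
proof -
  obtain i j m where "\<forall>e. env k l e \<longrightarrow> s e = e i" "\<forall>e. env k l e \<longrightarrow> t e = e j"
    "\<forall>e. env k l e \<longrightarrow> u e = e m"
    using assms by (auto simp: is_term_def)
  then show ?thesis by (intro definable_cong[OF assms(1)[of i j m]]) auto
qed

lemmas definable_basic = definable_mem definable_eq definable_not definable_conj definable_disj
  definable_imp definable_iff definable_all definable_ex definable_ex1
  term_var term_atoms

lemma definable_is_set:
  "is_term k l s \<Longrightarrow> definable k l (\<lambda>e. is_set V (s e))"
  unfolding is_set_def by (intro definable_basic)

lemma definable_is_subset:
  "is_term k l s \<Longrightarrow> is_term k l t \<Longrightarrow> definable k l (\<lambda>e. is_subset V (s e) (t e))"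
  by (rule definable_subst2) (unfold is_subset_def, intro definable_basic definable_is_set)

lemma definable_is_empty:
  "is_term k l s \<Longrightarrow> definable k l (\<lambda>e. is_empty V (s e))"
  by (rule definable_subst1) (unfold is_empty_def, intro definable_basic definable_is_set)

lemma definable_is_upair:
  "is_term k l s \<Longrightarrow> is_term k l t \<Longrightarrow> is_term k l u \<Longrightarrow> definable k l (\<lambda>e. is_upair V (s e) (t e) (u e))"
  by (rule definable_subst3) (unfold is_upair_def, intro definable_basic)

lemma definable_is_opair:
  "is_term k l s \<Longrightarrow> is_term k l t \<Longrightarrow> is_term k l u \<Longrightarrow> definable k l (\<lambda>e. is_opair V (s e) (t e) (u e))"
  by (rule definable_subst3) (unfold is_opair_def, intro definable_basic definable_is_upair)

lemma definable_maps_to: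
  "is_term k l s \<Longrightarrow> is_term k l t \<Longrightarrow> is_term k l u \<Longrightarrow> definable k l (\<lambda>e. maps_to V (s e) (t e) (u e))"
  by (rule definable_subst3) (unfold maps_to_def, intro definable_basic definable_is_opair)

lemma definable_is_function:
  "is_term k l s \<Longrightarrow> is_term k l t \<Longrightarrow> is_term k l u \<Longrightarrow> definable k l (\<lambda>e. is_function V (s e) (t e) (u e))"
  by (rule definable_subst3)
    (unfold is_function_def, intro definable_basic definable_is_set definable_is_opair definable_maps_to)

lemma definable_is_bijection:
  "is_term k l s \<Longrightarrow> is_term k l t \<Longrightarrow> is_term k l u \<Longrightarrow> definable k l (\<lambda>e. is_bijection V (s e) (t e) (u e))"
  by (rule definable_subst3)
    (unfold is_bijection_def, intro definable_basic definable_is_function definable_maps_to)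

lemma definable_is_transitive:
  "is_term k l s \<Longrightarrow> definable k l (\<lambda>e. is_transitive V (s e))"
  by (rule definable_subst1) (unfold is_transitive_def, intro definable_basic definable_is_set)

lemma definable_is_succ:
  "is_term k l s \<Longrightarrow> is_term k l t \<Longrightarrow> definable k l (\<lambda>e. is_succ V (s e) (t e))"
  by (rule definable_subst2) (unfold is_succ_def, intro definable_basic)

lemma definable_is_natural:
  "is_term k l s \<Longrightarrow> definable k l (\<lambda>e. is_natural V (s e))"
  by (rule definable_subst1)
    (unfold is_natural_def is_ordinal_def,
      intro definable_basic definable_is_transitive definable_is_empty definable_is_succ)

lemma definable_is_finite:
  "is_term k l s \<Longrightarrow> definable k l (\<lambda>e. is_finite V (s e))"
  by (rule definable_subst1)
    (unfold is_finite_def, intro definable_basic definable_is_set definable_is_natural definable_is_bijection)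

lemma definable_in_trans_closure:
  "is_term k l s \<Longrightarrow> is_term k l t \<Longrightarrow> definable k l (\<lambda>e. in_trans_closure V (s e) (t e))"
  by (rule definable_subst2)
    (unfold in_trans_closure_def, intro definable_basic definable_is_transitive)

lemmas definable_intros = definable_basic term_param definable_is_set definable_is_subset definable_is_empty
  definable_is_opair definable_maps_to definable_is_bijection definable_is_transitive
  definable_is_natural definable_is_finite definable_in_trans_closure

text \<open>Turns the schema into a comprehension principle for predicates. The tested element is at
  position 0, so the parameters start at position 1.\<close>

lemma separation_definable:
  assumes "x \<in> univ V" "set l \<subseteq> univ V" "definable 1 l (\<lambda>e. Q (e 0))"
  obtains z where "z \<in> univ V" "is_set V z" "elts V z = {y \<in> elts V x. Q y}"
proof -
  obtain \<phi> where \<phi>: "\<forall>e. env 1 l e \<longrightarrow> (sat V e \<phi> \<longleftrightarrow> Q (e 0))"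
    using assms(3) unfolding definable_def by blast
  \<comment> \<open>Positions beyond the parameters only have to hold some element of the universe;
    \<open>atoms V\<close> serves as filler.\<close>
  define p where "p i = (if i < Suc (length l) then (atoms V # l) ! i else atoms V)" for i
  have "(atoms V # l) ! i \<in> univ V" if "i < Suc (length l)" for i
  proof -
    have "(atoms V # l) ! i \<in> set (atoms V # l)" using that by (metis length_Cons nth_mem)
    then show ?thesis using assms(2) atoms_in_univ by auto
  qed
  then have p: "range p \<subseteq> univ V" using atoms_in_univ by (auto simp: p_def)
  have e: "env 1 l (case_nat y p)" if "y \<in> univ V" for y
    using p that by (auto simp: env_def p_def image_subset_iff split: nat.splits)
  obtain z where "z \<in> univ V" "is_set V z"
    "\<forall>y\<in>univ V. y \<epsilon>\<^bsub>V\<^esub> z \<longleftrightarrow> y \<epsilon>\<^bsub>V\<^esub> x \<and> sat V (case_nat y p) \<phi>"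
    using separation p assms(1) by meson
  then show thesis using \<phi> e by (intro that[of z]) (auto simp: elts_def)
qed

section \<open>Basic constructions\<close>

lemma set_if_elts: "x \<in> univ V \<Longrightarrow> z \<in> elts V x \<Longrightarrow> is_set V x"
  using atoms_no_elements by (auto simp: elts_def is_set_def)

lemma elts_eqI:
  assumes "x \<in> univ V" "y \<in> univ V" "is_set V x" "is_set V y" "elts V x = elts V y"
  shows "x = y"
  using extensionality assms unfolding elts_def by blast

lemma ex_pair:
  assumes "x \<in> univ V" "y \<in> univ V"
  obtains p where "p \<in> univ V" "is_set V p" "elts V p = {x, y}"
proof -
  obtain p where "p \<in> univ V" "elts V p = {x, y}"
    using pairing[rule_format, OF assms] is_upair_iff[OF assms] by blast
  then show thesis using set_if_elts[of p x] that by auto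
qed

lemma ex_Union:
  assumes "x \<in> univ V"
  obtains u where "u \<in> univ V" "is_set V u" "elts V u = (\<Union>y\<in>elts V x. elts V y)"
  using union assms that by (auto simp: is_union_iff)

lemma ex_Un:
  assumes "x \<in> univ V" "y \<in> univ V"
  obtains u where "u \<in> univ V" "is_set V u" "elts V u = elts V x \<union> elts V y"
proof -
  obtain p where p: "p \<in> univ V" "elts V p = {x, y}" using ex_pair assms by metis
  obtain u where "u \<in> univ V" "is_set V u" "elts V u = (\<Union>y\<in>elts V p. elts V y)"
    using ex_Union[OF p(1)] .
  then show thesis using that p by auto
qed

lemma ex_insert:
  assumes "a \<in> univ V" "x \<in> univ V"
  obtains u where "u \<in> univ V" "is_set V u" "elts V u = insert a (elts V x)"
proof -
  obtain p where p: "p \<in> univ V" "elts V p = {a, a}" using ex_pair assms by metis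
  obtain u where "u \<in> univ V" "is_set V u" "elts V u = elts V p \<union> elts V x"
    using ex_Un[OF p(1) assms(2)] .
  then show thesis using that p by auto
qed

lemma ex_empty:
  obtains z where "z \<in> univ V" "is_set V z" "elts V z = {}"
  using empty_set that by (auto simp: is_empty_iff)

lemma ex_Pow:
  assumes "x \<in> univ V" "is_set V x"
  obtains p where "p \<in> univ V" "is_set V p" "elts V p = {y \<in> univ V. is_set V y \<and> elts V y \<subseteq> elts V x}"
proof -
  obtain p where p: "p \<in> univ V" "\<forall>y\<in>univ V. y \<epsilon>\<^bsub>V\<^esub> p \<longleftrightarrow> is_subset V y x"
    using power_set assms by blast
  then have "elts V p = {y \<in> univ V. is_set V y \<and> elts V y \<subseteq> elts V x}"
    using assms by (auto simp: elts_def is_subset_iff)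
  then show thesis using that[OF p(1)] set_if_elts[OF p(1), of x] assms by auto
qed

lemma ex_opair:
  assumes "a \<in> univ V" "b \<in> univ V"
  obtains p where "p \<in> univ V" "is_opair V a b p"
proof -
  obtain u where u: "u \<in> univ V" "elts V u = {a, a}" using ex_pair assms by metis
  obtain v where v: "v \<in> univ V" "elts V v = {a, b}" using ex_pair assms by metis
  obtain p where "p \<in> univ V" "elts V p = {u, v}" using ex_pair u v by metis
  then show thesis using that u v assms by (auto simp: is_opair_iff)
qed

lemma opair_unique:
  assumes "is_opair V a b p" "is_opair V a b q" "a \<in> univ V" "b \<in> univ V" "p \<in> univ V" "q \<in> univ V"
  shows "p = q"
proof -
  obtain u v where 1: "u \<in> univ V" "v \<in> univ V" "elts V u = {a}" "elts V v = {a, b}" "elts V p = {u, v}"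
    using assms by (auto simp: is_opair_iff)
  obtain u' v' where 2: "u' \<in> univ V" "v' \<in> univ V" "elts V u' = {a}" "elts V v' = {a, b}" "elts V q = {u', v'}"
    using assms by (auto simp: is_opair_iff)
  have "u = u'" using 1 2 by (intro elts_eqI) (auto intro: set_if_elts[of _ a])
  moreover have "v = v'" using 1 2 by (intro elts_eqI) (auto intro: set_if_elts[of _ a])
  ultimately show "p = q" using 1 2 assms by (intro elts_eqI) (auto intro: set_if_elts[of _ u])
qed

lemma opair_set: "is_opair V a b p \<Longrightarrow> a \<in> univ V \<Longrightarrow> b \<in> univ V \<Longrightarrow> p \<in> univ V \<Longrightarrow> is_set V p"
  by (auto simp: is_opair_iff intro: set_if_elts)

lemma maps_to_opair:
  assumes "is_opair V a b p" "a \<in> univ V" "b \<in> univ V" "p \<in> univ V"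
  shows "maps_to V f a b \<longleftrightarrow> p \<in> elts V f"
  using assms opair_unique[OF assms(1) _ assms(2-4)] elts_univD[of _ V f] unfolding maps_to_iff by blast

text \<open>Kuratowski pairs over \<open>x \<union> y\<close> lie in its double power set, from
  which the relation is separated. Under the two quantifiers over the components, \<open>b\<close>
  is at position 0, \<open>a\<close> at 1 and the pair at 2, so the parameters start at
  \<open>Suc (Suc 1)\<close>.\<close>

lemma ex_relation:
  assumes "x \<in> univ V" "y \<in> univ V" "is_set V x" "is_set V y"
    and "set l \<subseteq> univ V" "x \<in> set l" "y \<in> set l"
    and "definable (Suc (Suc 1)) l (\<lambda>e. R (e (Suc 0)) (e 0))"
  obtains r where "r \<in> univ V" "is_set V r"
    "elts V r = {p \<in> univ V. \<exists>a\<in>elts V x. \<exists>b\<in>elts V y. is_opair V a b p \<and> R a b}"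
    "\<And>a b. a \<in> univ V \<Longrightarrow> b \<in> univ V \<Longrightarrow> maps_to V r a b \<longleftrightarrow> a \<in> elts V x \<and> b \<in> elts V y \<and> R a b"
proof -
  obtain u where u: "u \<in> univ V" "is_set V u" "elts V u = elts V x \<union> elts V y"
    using ex_Un[OF assms(1,2)] .
  obtain p1 where p1: "p1 \<in> univ V" "is_set V p1" "elts V p1 = {y \<in> univ V. is_set V y \<and> elts V y \<subseteq> elts V u}"
    using ex_Pow[OF u(1,2)] .
  obtain p2 where p2: "p2 \<in> univ V" "is_set V p2" "elts V p2 = {y \<in> univ V. is_set V y \<and> elts V y \<subseteq> elts V p1}"
    using ex_Pow[OF p1(1,2)] .
  have "definable 1 l (\<lambda>e. \<exists>a\<in>univ V. \<exists>b\<in>univ V. a \<epsilon>\<^bsub>V\<^esub> x \<and> b \<epsilon>\<^bsub>V\<^esub> y \<and> is_opair V a b (e 0) \<and> R a b)"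
    by (intro definable_intros assms)
  from separation_definable[OF p2(1) assms(5) this]
  obtain r where r: "r \<in> univ V" "is_set V r"
    "elts V r = {p \<in> elts V p2. \<exists>a\<in>univ V. \<exists>b\<in>univ V. a \<epsilon>\<^bsub>V\<^esub> x \<and> b \<epsilon>\<^bsub>V\<^esub> y \<and> is_opair V a b p \<and> R a b}"
    by blast
  have "p \<in> elts V p2" if pab: "p \<in> univ V" "is_opair V a b p" "a \<in> elts V x" "b \<in> elts V y" for p a b
  proof -
    have ab: "a \<in> univ V" "b \<in> univ V" using pab by (auto dest: elts_univD)
    obtain v w where vw: "v \<in> univ V" "w \<in> univ V" "elts V v = {a}" "elts V w = {a, b}" "elts V p = {v, w}"
      using pab(2) is_opair_iff[OF ab] by blast
    have "is_set V v" "is_set V w" "is_set V p"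
      using set_if_elts[of v a] set_if_elts[of w a] set_if_elts[of p v] vw pab(1) by simp_all
    then show ?thesis using pab vw unfolding p2 p1 u by auto
  qed
  then have el: "elts V r = {p \<in> univ V. \<exists>a\<in>elts V x. \<exists>b\<in>elts V y. is_opair V a b p \<and> R a b}"
    unfolding r(3) by (auto simp: elts_def)
  have "maps_to V r a b \<longleftrightarrow> a \<in> elts V x \<and> b \<in> elts V y \<and> R a b" if ab: "a \<in> univ V" "b \<in> univ V" for a b
  proof -
    obtain p where p: "p \<in> univ V" "is_opair V a b p" using ex_opair[OF ab] .
    have "p \<in> elts V r \<longleftrightarrow> a \<in> elts V x \<and> b \<in> elts V y \<and> R a b"
    proof
      assume "p \<in> elts V r"
      then obtain a' b' where *: "a' \<in> elts V x" "b' \<in> elts V y" "is_opair V a' b' p" "R a' b'"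
        unfolding el by blast
      then have "a = a' \<and> b = b'"
        by (intro opair_inject[OF p(2) *(3) ab] elts_univD[OF *(1)] elts_univD[OF *(2)])
      then show "a \<in> elts V x \<and> b \<in> elts V y \<and> R a b" using * by simp
    qed (use p in \<open>auto simp: el\<close>)
    then show ?thesis using maps_to_opair[OF p(2) ab p(1)] by simp
  qed
  then show thesis using that[OF r(1,2) el] by blast
qed

lemma mem_irrefl: "x \<in> univ V \<Longrightarrow> x \<notin> elts V x"
proof
  assume x: "x \<in> univ V" "x \<in> elts V x"
  obtain p where p: "p \<in> univ V" "elts V p = {x, x}" using ex_pair x by metis
  then obtain y where "y \<in> elts V p" "disjoint_in V y p"
    using foundation unfolding elts_def by blast
  then show False using p x by (auto simp: disjoint_in_iff)
qed

section \<open>Natural numbers\<close>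

lemma natural_set: "n \<in> univ V \<Longrightarrow> is_natural V n \<Longrightarrow> is_set V n"
  by (simp add: is_natural_iff is_transitive_iff)

lemma natural_mem:
  assumes "n \<in> univ V" "is_natural V n" "m \<in> elts V n"
  shows "is_natural V m"
proof -
  have m: "m \<in> univ V" using assms(3) by (rule elts_univD)
  have "elts V m \<subseteq> elts V n" using assms by (auto simp: is_natural_iff is_transitive_iff)
  then show ?thesis using assms m unfolding is_natural_iff[OF assms(1)] is_natural_iff[OF m] by blast
qed

lemma natural_cases:
  assumes "n \<in> univ V" "is_natural V n"
  obtains "elts V n = {}"
  | k where "k \<in> univ V" "is_natural V k" "elts V n = insert k (elts V k)"
proof -
  have "is_empty V n \<or> (\<exists>k\<in>univ V. is_succ V k n)"
    using assms by (auto simp: is_natural_iff)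
  then show thesis
  proof
    assume "is_empty V n"
    then show thesis using that by (simp add: is_empty_iff)
  next
    assume "\<exists>k\<in>univ V. is_succ V k n"
    then obtain k where k: "k \<in> univ V" "elts V n = insert k (elts V k)" by (auto simp: is_succ_iff)
    then show thesis using that(2)[OF k(1) _ k(2)] natural_mem[OF assms, of k] by simp
  qed
qed

lemma natural_succ:
  assumes "n \<in> univ V" "is_natural V n" "s \<in> univ V" "elts V s = insert n (elts V n)"
  shows "is_natural V s"
proof -
  have "is_set V s" using set_if_elts[of s n] assms by simp
  moreover have "is_succ V n s" using assms by (simp add: is_succ_iff)
  ultimately show ?thesis
    using assms(1,2,4) unfolding is_natural_iff[OF assms(1)] is_natural_iff[OF assms(3)]
    by (auto simp: is_transitive_iff)
qed

lemma natural_zero: "z \<in> univ V \<Longrightarrow> is_set V z \<Longrightarrow> elts V z = {} \<Longrightarrow> is_natural V z"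
  by (simp add: is_natural_iff is_transitive_iff is_empty_iff)

text \<open>Foundation supplies a membership-minimal counterexample in the successor of
  \<open>n\<close>. It is zero or a successor, and in the latter case its predecessor is no
  counterexample.\<close>

lemma natural_induct_definable:
  assumes "set l \<subseteq> univ V" "definable 1 l (\<lambda>e. Q (e 0))"
    and "n \<in> univ V" "is_natural V n"
    and zero: "\<And>z. z \<in> univ V \<Longrightarrow> is_set V z \<Longrightarrow> elts V z = {} \<Longrightarrow> Q z"
    and succ: "\<And>k s. k \<in> univ V \<Longrightarrow> s \<in> univ V \<Longrightarrow> is_natural V k \<Longrightarrow> is_natural V s \<Longrightarrow>
      elts V s = insert k (elts V k) \<Longrightarrow> Q k \<Longrightarrow> Q s"
  shows "Q n"
proof (rule ccontr)
  assume "\<not> Q n"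
  obtain s where s: "s \<in> univ V" "elts V s = insert n (elts V n)" using ex_insert[OF assms(3,3)] by metis
  obtain c where c: "c \<in> univ V" "elts V c = {y \<in> elts V s. \<not> Q y}"
    using separation_definable[OF s(1) assms(1) definable_not[OF assms(2)]] by metis
  have "n \<in> elts V c" using \<open>\<not> Q n\<close> c s by simp
  then have "\<exists>y\<in>univ V. y \<epsilon>\<^bsub>V\<^esub> c"
    using assms(3) by (intro bexI[of _ n]) (simp_all add: mem_elts_iff)
  then obtain m where "m \<in> univ V" "m \<epsilon>\<^bsub>V\<^esub> c" "disjoint_in V m c"
    using bspec[OF foundation c(1)] by blast
  then have m: "m \<in> elts V c" "elts V m \<inter> elts V c = {}"
    by (simp_all add: mem_elts_iff disjoint_in_iff)
  have mu: "m \<in> univ V" using m(1) by (rule elts_univD)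
  have mn: "is_natural V m" using m c s natural_mem[OF assms(3,4)] assms(4) by auto
  from mu mn show False
  proof (cases rule: natural_cases)
    case 1
    then show False using zero[OF mu natural_set[OF mu mn]] m c by simp
  next
    case (2 k)
    \<comment> \<open>Minimality only yields that \<open>k\<close> is not in \<open>c\<close>. To
      conclude \<open>Q k\<close>, \<open>k\<close> must lie in the set \<open>s\<close> from which
      \<open>c\<close> was separated, which follows from transitivity of \<open>s\<close>.\<close>
    have "is_natural V s" using natural_succ assms(3,4) s by blast
    then have "elts V m \<subseteq> elts V s" using m c s(1) by (auto simp: is_natural_iff is_transitive_iff)
    then have "Q k" using m c 2 by auto
    then show False using succ[OF 2(1) mu 2(2) mn 2(3)] m c by simp
  qed
qed

text \<open>Discreteness of the order of the naturals, by induction on \<open>m\<close>; it drives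
  the successor step of \<open>natural_linear\<close>.\<close>

lemma natural_succ_mono:
  assumes "m \<in> univ V" "is_natural V m" "k \<in> elts V m" "s \<in> univ V" "elts V s = insert k (elts V k)"
  shows "s \<in> elts V m \<or> s = m"
proof -
  have k: "k \<in> univ V" using assms(3) by (rule elts_univD)
  have "set [k, s] \<subseteq> univ V" using k assms by simp
  moreover have "definable 1 [k, s] (\<lambda>e. k \<epsilon>\<^bsub>V\<^esub> e 0 \<longrightarrow> s \<epsilon>\<^bsub>V\<^esub> e 0 \<or> s = e 0)"
    by (intro definable_intros) simp_all
  ultimately have "k \<epsilon>\<^bsub>V\<^esub> m \<longrightarrow> s \<epsilon>\<^bsub>V\<^esub> m \<or> s = m" using assms(1,2)
  proof (rule natural_induct_definable)
    fix z assume "elts V z = {}"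
    then show "k \<epsilon>\<^bsub>V\<^esub> z \<longrightarrow> s \<epsilon>\<^bsub>V\<^esub> z \<or> s = z" using k by (auto simp: elts_def)
  next
    fix n t assume t: "n \<in> univ V" "t \<in> univ V" "elts V t = insert n (elts V n)"
      and IH: "k \<epsilon>\<^bsub>V\<^esub> n \<longrightarrow> s \<epsilon>\<^bsub>V\<^esub> n \<or> s = n"
    \<comment> \<open>In this case \<open>s\<close> and \<open>t\<close> are both successors of the
      same set, and extensionality identifies them.\<close>
    have "s = t" if "k = n" using that assms(4,5) t by (intro elts_eqI) (auto intro: set_if_elts)
    then show "k \<epsilon>\<^bsub>V\<^esub> t \<longrightarrow> s \<epsilon>\<^bsub>V\<^esub> t \<or> s = t"
      using IH t k assms(4) by (auto simp: mem_elts_iff)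
  qed
  then show ?thesis using assms k by (auto simp: mem_elts_iff)
qed

text \<open>Induction on \<open>n\<close> with \<open>m\<close> fixed. The zero case is itself an
  induction, on \<open>m\<close>; in the successor step the case of \<open>k\<close> in
  \<open>m\<close> is \<open>natural_succ_mono\<close>.\<close>

lemma natural_linear:
  assumes "m \<in> univ V" "is_natural V m" "n \<in> univ V" "is_natural V n"
  shows "m \<in> elts V n \<or> m = n \<or> n \<in> elts V m"
proof -
  have lm: "set [m] \<subseteq> univ V" using assms by simp
  have zero: "z \<in> elts V m \<or> z = m" if z: "z \<in> univ V" "is_set V z" "elts V z = {}" for z
  proof -
    have "set [z] \<subseteq> univ V" using z by simp
    moreover have "definable 1 [z] (\<lambda>e. z \<epsilon>\<^bsub>V\<^esub> e 0 \<or> z = e 0)" by (intro definable_intros) simp_all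
    ultimately have "z \<epsilon>\<^bsub>V\<^esub> m \<or> z = m" using assms(1,2)
    proof (rule natural_induct_definable)
      fix y assume "y \<in> univ V" "is_set V y" "elts V y = {}"
      then show "z \<epsilon>\<^bsub>V\<^esub> y \<or> z = y" using z elts_eqI[of z y] by simp
    qed (use z in \<open>auto simp: mem_elts_iff\<close>)
    then show ?thesis using z by (simp add: mem_elts_iff)
  qed
  have "definable 1 [m] (\<lambda>e. m \<epsilon>\<^bsub>V\<^esub> e 0 \<or> m = e 0 \<or> e 0 \<epsilon>\<^bsub>V\<^esub> m)"
    by (intro definable_intros) simp_all
  from lm this assms(3,4) have "m \<epsilon>\<^bsub>V\<^esub> n \<or> m = n \<or> n \<epsilon>\<^bsub>V\<^esub> m"
  proof (rule natural_induct_definable)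
    fix z assume "z \<in> univ V" "is_set V z" "elts V z = {}"
    then show "m \<epsilon>\<^bsub>V\<^esub> z \<or> m = z \<or> z \<epsilon>\<^bsub>V\<^esub> m" using zero[of z] by (auto simp: mem_elts_iff)
  next
    fix k s assume ks: "k \<in> univ V" "s \<in> univ V" "elts V s = insert k (elts V k)"
      and IH: "m \<epsilon>\<^bsub>V\<^esub> k \<or> m = k \<or> k \<epsilon>\<^bsub>V\<^esub> m"
    then show "m \<epsilon>\<^bsub>V\<^esub> s \<or> m = s \<or> s \<epsilon>\<^bsub>V\<^esub> m"
      using natural_succ_mono[OF assms(1,2) _ ks(2,3)] assms(1) by (auto simp: mem_elts_iff)
  qed
  then show ?thesis using assms by (simp add: mem_elts_iff)
qed

lemma natural_upper_bound:
  assumes "m \<in> univ V" "is_natural V m" "n \<in> univ V" "is_natural V n"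
  obtains k where "k \<in> univ V" "is_natural V k" "elts V m \<subseteq> elts V k" "elts V n \<subseteq> elts V k"
proof -
  have "elts V m \<subseteq> elts V n \<or> elts V n \<subseteq> elts V m"
    using natural_linear[OF assms] assms by (auto simp: is_natural_iff is_transitive_iff)
  then show thesis using that assms by blast
qed

section \<open>Finite sets\<close>

lemma ex_bijection:
  assumes "x \<in> univ V" "y \<in> univ V" "is_set V x" "is_set V y"
    and "set l \<subseteq> univ V" "x \<in> set l" "y \<in> set l"
    and "definable (Suc (Suc 1)) l (\<lambda>e. R (e (Suc 0)) (e 0))"
    and "\<And>a. a \<in> elts V x \<Longrightarrow> \<exists>!b. b \<in> elts V y \<and> R a b"
    and "\<And>b. b \<in> elts V y \<Longrightarrow> \<exists>!a. a \<in> elts V x \<and> R a b"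
  obtains r where "r \<in> univ V" "is_bijection V r x y"
    "\<And>a b. a \<in> univ V \<Longrightarrow> b \<in> univ V \<Longrightarrow> maps_to V r a b \<longleftrightarrow> a \<in> elts V x \<and> b \<in> elts V y \<and> R a b"
proof -
  obtain r where r: "r \<in> univ V" "is_set V r"
    "elts V r = {p \<in> univ V. \<exists>a\<in>elts V x. \<exists>b\<in>elts V y. is_opair V a b p \<and> R a b}"
    "\<And>a b. a \<in> univ V \<Longrightarrow> b \<in> univ V \<Longrightarrow> maps_to V r a b \<longleftrightarrow> a \<in> elts V x \<and> b \<in> elts V y \<and> R a b"
    by (rule ex_relation[where R = R, OF assms(1-8)], blast)
  have "(b \<in> univ V \<and> maps_to V r a b) \<longleftrightarrow> (b \<in> elts V y \<and> R a b)" if "a \<in> elts V x" for a b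
    using r(4)[OF elts_univD[OF that]] that by (auto dest: elts_univD)
  then have "\<forall>a\<in>elts V x. \<exists>!b. b \<in> univ V \<and> maps_to V r a b" using assms(9) by simp
  moreover have "(a \<in> univ V \<and> maps_to V r a b) \<longleftrightarrow> (a \<in> elts V x \<and> R a b)" if "b \<in> elts V y" for a b
    using r(4)[OF _ elts_univD[OF that]] that by (auto dest: elts_univD)
  then have "\<forall>b\<in>elts V y. \<exists>!a. a \<in> univ V \<and> maps_to V r a b" using assms(10) by simp
  ultimately have "is_bijection V r x y"
    unfolding is_bijection_iff is_function_iff using r(2,3) by auto
  then show thesis using that r(1,4) by blast
qed

lemma finite_set: "is_finite V x \<Longrightarrow> is_set V x"
  by (simp add: is_finite_def)

lemma finite_empty:
  assumes "z \<in> univ V" "is_set V z" "elts V z = {}"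
  shows "is_finite V z"
proof -
  \<comment> \<open>The empty set plays all three roles: the set to be counted, the number zero and
    the bijection.\<close>
  have "is_bijection V z z z" using assms by (simp add: is_bijection_iff is_function_iff)
  then show ?thesis using natural_zero[OF assms] assms unfolding is_finite_def by blast
qed

text \<open>The bijection \<open>f\<close> onto \<open>n\<close> is extended by the pair
  \<open>(a, n)\<close>, with values in the successor of \<open>n\<close>. As \<open>a\<close> is
  not in \<open>x\<close> and \<open>n\<close> is not in \<open>n\<close>, the new pair clashes with
  no old one.\<close>

lemma finite_insert:
  assumes "x \<in> univ V" "is_finite V x" "a \<in> univ V" "y \<in> univ V" "is_set V y" "elts V y = insert a (elts V x)"
  shows "is_finite V y"
proof (cases "a \<in> elts V x")
  case True
  then have "x = y" using assms by (intro elts_eqI) (auto simp: finite_set)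
  then show ?thesis using assms by simp
next
  case False
  obtain n f where nf: "n \<in> univ V" "f \<in> univ V" "is_natural V n" "is_bijection V f x n"
    using assms(2) unfolding is_finite_def by blast
  obtain s where s: "s \<in> univ V" "is_set V s" "elts V s = insert n (elts V n)"
    using ex_insert[OF nf(1) nf(1)] .
  have fn: "is_function V f x n" using nf(4) by (rule bijection_is_function)
  have n: "n \<notin> elts V n" using mem_irrefl nf(1) by simp
  let ?l = "[y, s, f, a, n]"
  have l: "set ?l \<subseteq> univ V" "y \<in> set ?l" "s \<in> set ?l" using s nf assms by auto
  have d: "definable (Suc (Suc 1)) ?l (\<lambda>e. maps_to V f (e (Suc 0)) (e 0) \<or> e (Suc 0) = a \<and> e 0 = n)"
    by (intro definable_intros) simp_all
  have tot: "\<exists>!v. v \<in> elts V s \<and> (maps_to V f u v \<or> u = a \<and> v = n)" if "u \<in> elts V y" for u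
  proof (cases "u = a")
    case True
    have "\<not> maps_to V f a v" if "v \<in> elts V s" for v
      using function_maps_toD(1)[OF fn _ assms(3) elts_univD[OF that]] False by blast
    then show ?thesis using True s(3) by blast
  next
    case False
    then have u: "u \<in> elts V x" using that assms(6) by blast
    obtain v where v: "v \<in> elts V n" "maps_to V f u v" using function_total[OF fn u] .
    show ?thesis
      using False v s(3) function_unique[OF fn _ v(2) elts_univD[OF u] elts_univD elts_univD[OF v(1)]] by blast
  qed
  have onto: "\<exists>!u. u \<in> elts V y \<and> (maps_to V f u v \<or> u = a \<and> v = n)" if "v \<in> elts V s" for v
  proof (cases "v = n")
    case True
    have "\<not> maps_to V f u n" if "u \<in> elts V y" for u
      using function_maps_toD(2)[OF fn _ elts_univD[OF that] nf(1)] n by blast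
    then show ?thesis using True assms(6) by blast
  next
    case False
    then have v: "v \<in> elts V n" using that s(3) by blast
    obtain u where u: "u \<in> elts V x" "maps_to V f u v" using bijection_onto[OF nf(4) v] .
    show ?thesis
      using False u assms(6) bijection_inject[OF nf(4) _ u(2) elts_univD elts_univD[OF u(1)] elts_univD[OF v]] by blast
  qed
  obtain r where "r \<in> univ V" "is_bijection V r y s"
    by (rule ex_bijection[where R = "\<lambda>u v. maps_to V f u v \<or> u = a \<and> v = n",
        OF assms(4) s(1) assms(5) s(2) l d tot onto], blast)
  moreover have "is_natural V s" using natural_succ nf s by blast
  ultimately show ?thesis using assms(5) s(1) unfolding is_finite_def by blast
qed

text \<open>Induction on the number of elements, for all subsets \<open>u\<close> of
  \<open>x\<close> and all bijections at once, because removing an element changes both. The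
  property is given as a set \<open>s\<close>, which makes the induction statement a formula with
  parameters \<open>x\<close> and \<open>s\<close>.\<close>

lemma finite_induct:
  assumes "x \<in> univ V" "is_finite V x" "s \<in> univ V"
    and zero: "\<And>z. z \<in> univ V \<Longrightarrow> is_set V z \<Longrightarrow> elts V z = {} \<Longrightarrow> z \<in> elts V s"
    and ins: "\<And>u a v. u \<in> elts V s \<Longrightarrow> a \<in> elts V x \<Longrightarrow> v \<in> univ V \<Longrightarrow> is_set V v \<Longrightarrow>
      elts V v = insert a (elts V u) \<Longrightarrow> elts V v \<subseteq> elts V x \<Longrightarrow> v \<in> elts V s"
  shows "x \<in> elts V s"
proof -
  obtain n f where nf: "n \<in> univ V" "f \<in> univ V" "is_natural V n" "is_bijection V f x n"
    using assms(2) unfolding is_finite_def by blast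
  have l: "set [x, s] \<subseteq> univ V" using assms by simp
  have d: "definable 1 [x, s] (\<lambda>e. \<forall>u\<in>univ V. \<forall>f\<in>univ V. is_bijection V f u (e 0) \<and> is_subset V u x \<longrightarrow> u \<epsilon>\<^bsub>V\<^esub> s)"
    by (intro definable_intros) simp_all
  have "\<forall>u\<in>univ V. \<forall>f\<in>univ V. is_bijection V f u n \<and> is_subset V u x \<longrightarrow> u \<epsilon>\<^bsub>V\<^esub> s"
    using l d nf(1,3)
  proof (rule natural_induct_definable)
    fix z assume z: "z \<in> univ V" "is_set V z" "elts V z = {}"
    show "\<forall>u\<in>univ V. \<forall>f\<in>univ V. is_bijection V f u z \<and> is_subset V u x \<longrightarrow> u \<epsilon>\<^bsub>V\<^esub> s"
    proof (intro ballI impI)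
      fix u f assume u: "u \<in> univ V" "is_bijection V f u z \<and> is_subset V u x"
      then have "elts V u = {}"
        using function_total[OF bijection_is_function, of V f u z] z(3) by blast
      then show "u \<epsilon>\<^bsub>V\<^esub> s" using zero[of u] u by (simp add: is_subset_iff mem_elts_iff)
    qed
  next
    fix n t assume n: "n \<in> univ V" "t \<in> univ V" "elts V t = insert n (elts V n)" "is_natural V n"
      and IH: "\<forall>u\<in>univ V. \<forall>f\<in>univ V. is_bijection V f u n \<and> is_subset V u x \<longrightarrow> u \<epsilon>\<^bsub>V\<^esub> s"
    show "\<forall>u\<in>univ V. \<forall>f\<in>univ V. is_bijection V f u t \<and> is_subset V u x \<longrightarrow> u \<epsilon>\<^bsub>V\<^esub> s"
    proof (intro ballI impI)
      fix u f assume u: "u \<in> univ V" "f \<in> univ V" "is_bijection V f u t \<and> is_subset V u x"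
      then have bij: "is_bijection V f u t" and sub: "is_set V u" "elts V u \<subseteq> elts V x"
        by (simp_all add: is_subset_iff)
      have fn: "is_function V f u t" using bij by (rule bijection_is_function)
      have nn: "n \<notin> elts V n" using mem_irrefl n(1) by simp
      obtain a where a: "a \<in> elts V u" "maps_to V f a n" using bijection_onto[OF bij, of n] n(3) by blast
      have au: "a \<in> univ V" using a(1) by (rule elts_univD)
      have d: "definable 1 [a] (\<lambda>e. e 0 \<noteq> a)" by (intro definable_intros) simp_all
      have l: "set [a] \<subseteq> univ V" using au by simp
      \<comment> \<open>\<open>a\<close> is the preimage of the top element \<open>n\<close> of
        \<open>t\<close>; on what remains of \<open>u\<close>, \<open>f\<close> restricts to a
        bijection onto \<open>n\<close>.\<close>
      obtain u' where u': "u' \<in> univ V" "is_set V u'" "elts V u' = {y \<in> elts V u. y \<noteq> a}"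
        using separation_definable[where Q = "\<lambda>y. y \<noteq> a", OF u(1) l d] .
      have l': "set [u', n, f] \<subseteq> univ V" "u' \<in> set [u', n, f]" "n \<in> set [u', n, f]" using u u' n by auto
      have d': "definable (Suc (Suc 1)) [u', n, f] (\<lambda>e. maps_to V f (e (Suc 0)) (e 0))"
        by (intro definable_intros) simp_all
      have tot: "\<exists>!w. w \<in> elts V n \<and> maps_to V f v w" if "v \<in> elts V u'" for v
      proof -
        have v: "v \<in> elts V u" "v \<noteq> a" using that u' by auto
        obtain w where w: "w \<in> elts V t" "maps_to V f v w" using function_total[OF fn v(1)] .
        have "w \<noteq> n" using bijection_inject[OF bij a(2) _ au elts_univD[OF v(1)] n(1)] w v by blast
        then show ?thesis
          using w n(3) function_unique[OF fn _ w(2) elts_univD[OF v(1)] elts_univD elts_univD[OF w(1)]] by blast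
      qed
      have onto: "\<exists>!v. v \<in> elts V u' \<and> maps_to V f v w" if w: "w \<in> elts V n" for w
      proof -
        have "w \<in> elts V t" using w n by simp
        then obtain v where v: "v \<in> elts V u" "maps_to V f v w" using bijection_onto[OF bij] by metis
        have "v \<noteq> a" using function_unique[OF fn _ a(2) au elts_univD[OF w] n(1)] v w nn by blast
        then show ?thesis
          using v u' bijection_inject[OF bij _ v(2) elts_univD elts_univD[OF v(1)] elts_univD[OF w]] by blast
      qed
      obtain r where "r \<in> univ V" "is_bijection V r u' n"
        by (rule ex_bijection[where R = "maps_to V f",
            OF u'(1) n(1) u'(2) natural_set[OF n(1,4)] l' d' tot onto], blast)
      moreover have "is_subset V u' x" using u' u sub by (auto simp: is_subset_iff)
      ultimately have "u' \<in> elts V s" using IH u'(1) by (auto simp: mem_elts_iff)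
      then have "u \<in> elts V s" using a(1) sub u'(3) by (intro ins[of u' a u] u(1)) auto
      then show "u \<epsilon>\<^bsub>V\<^esub> s" using u(1) by (simp add: mem_elts_iff)
    qed
  qed
  moreover have "is_subset V x x" using assms by (simp add: is_subset_iff finite_set)
  ultimately have "x \<epsilon>\<^bsub>V\<^esub> s" using nf assms(1) by blast
  then show ?thesis using assms(1) by (simp add: mem_elts_iff)
qed

text \<open>The set \<open>s\<close> demanded by \<open>finite_induct\<close> is separated from the
  power set of \<open>x\<close>: the subsets of \<open>x\<close> that satisfy
  \<open>Q\<close>.\<close>

lemma finite_induct_definable:
  assumes "set l \<subseteq> univ V" "definable 1 l (\<lambda>e. Q (e 0))"
    and "x \<in> univ V" "is_finite V x"
    and zero: "\<And>z. z \<in> univ V \<Longrightarrow> is_set V z \<Longrightarrow> elts V z = {} \<Longrightarrow> Q z"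
    and ins: "\<And>u a v. Q u \<Longrightarrow> u \<in> univ V \<Longrightarrow> a \<in> elts V x \<Longrightarrow> v \<in> univ V \<Longrightarrow> is_set V v \<Longrightarrow>
      elts V v = insert a (elts V u) \<Longrightarrow> Q v"
  shows "Q x"
proof -
  obtain p where p: "p \<in> univ V" "is_set V p" "elts V p = {y \<in> univ V. is_set V y \<and> elts V y \<subseteq> elts V x}"
    using ex_Pow[OF assms(3) finite_set[OF assms(4)]] .
  obtain s where s: "s \<in> univ V" "elts V s = {y \<in> elts V p. Q y}"
    using separation_definable[OF p(1) assms(1,2)] by metis
  have "x \<in> elts V s" using assms(3,4) s(1)
  proof (rule finite_induct)
    fix z assume "z \<in> univ V" "is_set V z" "elts V z = {}"
    then show "z \<in> elts V s" using zero s(2) p(3) by simp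
  next
    fix u a v assume *: "u \<in> elts V s" "a \<in> elts V x" "v \<in> univ V" "is_set V v"
      "elts V v = insert a (elts V u)" "elts V v \<subseteq> elts V x"
    have "Q v" using ins[OF _ elts_univD[OF *(1)] *(2-5)] *(1) s(2) by simp
    then show "v \<in> elts V s" using * s(2) p(3) by simp
  qed
  then show ?thesis using s by simp
qed

text \<open>\<open>r\<close> is only asked to be single-valued from \<open>x\<close> to
  \<open>y\<close>, so that membership or the inverse of a permutation can take its place. The
  induction on \<open>x\<close> ranges over all \<open>w \<subseteq> y\<close> covered by the part
  of \<open>x\<close> collected so far.\<close>

lemma finite_image:
  assumes "x \<in> univ V" "is_finite V x" "r \<in> univ V" "y \<in> univ V" "is_set V y"
    and onto: "\<And>v. v \<in> elts V y \<Longrightarrow> \<exists>u\<in>elts V x. maps_to V r u v"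
    and single: "\<And>u v v'. u \<in> elts V x \<Longrightarrow> v \<in> elts V y \<Longrightarrow> v' \<in> elts V y \<Longrightarrow>
      maps_to V r u v \<Longrightarrow> maps_to V r u v' \<Longrightarrow> v = v'"
  shows "is_finite V y"
proof -
  let ?l = "[r, y]"
  have l: "set ?l \<subseteq> univ V" using assms by simp
  have d: "definable 1 ?l (\<lambda>e. \<forall>w\<in>univ V. is_subset V w y \<and>
      (\<forall>v\<in>univ V. v \<epsilon>\<^bsub>V\<^esub> w \<longrightarrow> (\<exists>u\<in>univ V. u \<epsilon>\<^bsub>V\<^esub> e 0 \<and> maps_to V r u v)) \<longrightarrow> is_finite V w)"
    by (intro definable_intros) simp_all
  have "\<forall>w\<in>univ V. is_subset V w y \<and>
      (\<forall>v\<in>univ V. v \<epsilon>\<^bsub>V\<^esub> w \<longrightarrow> (\<exists>u\<in>univ V. u \<epsilon>\<^bsub>V\<^esub> x \<and> maps_to V r u v)) \<longrightarrow> is_finite V w"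
    using l d assms(1,2)
  proof (rule finite_induct_definable)
    fix z assume z: "z \<in> univ V" "elts V z = {}"
    show "\<forall>w\<in>univ V. is_subset V w y \<and>
      (\<forall>v\<in>univ V. v \<epsilon>\<^bsub>V\<^esub> w \<longrightarrow> (\<exists>u\<in>univ V. u \<epsilon>\<^bsub>V\<^esub> z \<and> maps_to V r u v)) \<longrightarrow> is_finite V w"
    proof (intro ballI impI)
      fix w assume w: "w \<in> univ V" "is_subset V w y \<and>
        (\<forall>v\<in>univ V. v \<epsilon>\<^bsub>V\<^esub> w \<longrightarrow> (\<exists>u\<in>univ V. u \<epsilon>\<^bsub>V\<^esub> z \<and> maps_to V r u v))"
      then have "elts V w = {}" using z unfolding elts_def by blast
      then show "is_finite V w" using finite_empty w by (simp add: is_subset_iff)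
    qed
  next
    fix u a v assume uv: "u \<in> univ V" "a \<in> elts V x" "v \<in> univ V" "elts V v = insert a (elts V u)"
      and IH: "\<forall>w\<in>univ V. is_subset V w y \<and>
      (\<forall>v\<in>univ V. v \<epsilon>\<^bsub>V\<^esub> w \<longrightarrow> (\<exists>b\<in>univ V. b \<epsilon>\<^bsub>V\<^esub> u \<and> maps_to V r b v)) \<longrightarrow> is_finite V w"
    have au: "a \<in> univ V" using uv(2) by (rule elts_univD)
    show "\<forall>w\<in>univ V. is_subset V w y \<and>
      (\<forall>k\<in>univ V. k \<epsilon>\<^bsub>V\<^esub> w \<longrightarrow> (\<exists>b\<in>univ V. b \<epsilon>\<^bsub>V\<^esub> v \<and> maps_to V r b k)) \<longrightarrow> is_finite V w"
    proof (intro ballI impI)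
      fix w assume w: "w \<in> univ V" "is_subset V w y \<and>
        (\<forall>k\<in>univ V. k \<epsilon>\<^bsub>V\<^esub> w \<longrightarrow> (\<exists>b\<in>univ V. b \<epsilon>\<^bsub>V\<^esub> v \<and> maps_to V r b k))"
      then have wy: "is_set V w" "elts V w \<subseteq> elts V y" by (auto simp: is_subset_iff)
      have ex: "\<exists>b\<in>elts V v. maps_to V r b k" if "k \<in> elts V w" for k
        using w(2) that unfolding elts_def by blast
      have d: "definable 1 [a, r] (\<lambda>e. \<not> maps_to V r a (e 0))" by (intro definable_intros) simp_all
      have l: "set [a, r] \<subseteq> univ V" using au assms(3) by simp
      \<comment> \<open>Without the values of \<open>r\<close> at \<open>a\<close>, the rest of
        \<open>w\<close> is covered by \<open>u\<close>; as \<open>r\<close> is single-valued, at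
        most one element has been removed.\<close>
      obtain w' where w': "w' \<in> univ V" "is_set V w'" "elts V w' = {k \<in> elts V w. \<not> maps_to V r a k}"
        using separation_definable[where Q = "\<lambda>k. \<not> maps_to V r a k", OF w(1) l d] .
      have "\<exists>b\<in>univ V. b \<epsilon>\<^bsub>V\<^esub> u \<and> maps_to V r b k" if kw: "k \<in> elts V w'" for k
      proof -
        obtain b where b: "b \<in> elts V v" "maps_to V r b k" using ex[of k] kw unfolding w'(3) by auto
        then have "b \<in> elts V u" using kw unfolding w'(3) uv(4) by auto
        then show ?thesis using b(2) by (auto simp: elts_def)
      qed
      then have "\<forall>k\<in>univ V. k \<epsilon>\<^bsub>V\<^esub> w' \<longrightarrow> (\<exists>b\<in>univ V. b \<epsilon>\<^bsub>V\<^esub> u \<and> maps_to V r b k)"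
        by (simp add: mem_elts_iff)
      moreover have "is_subset V w' y" using w'(2,3) wy assms(5) by (auto simp: is_subset_iff)
      ultimately have "is_finite V w'" using IH w'(1) by blast
      moreover have "elts V w = insert k (elts V w')" if "k \<in> elts V w" "maps_to V r a k" for k
        using w'(3) that single[OF uv(2)] wy by blast
      moreover have "w = w'" if "\<not> (\<exists>k\<in>elts V w. maps_to V r a k)"
        using that w w' wy by (intro elts_eqI) auto
      ultimately show "is_finite V w" using finite_insert[OF w'(1) _ elts_univD w(1) wy(1)] by metis
    qed
  qed
  moreover have "is_subset V y y" using assms by (simp add: is_subset_iff)
  moreover have "\<forall>v\<in>univ V. v \<epsilon>\<^bsub>V\<^esub> y \<longrightarrow> (\<exists>u\<in>univ V. u \<epsilon>\<^bsub>V\<^esub> x \<and> maps_to V r u v)"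
    using onto unfolding elts_def by blast
  ultimately show ?thesis using assms(4) by blast
qed

text \<open>The numbers that \<open>g\<close> assigns to the atoms of a finite set have an upper
  bound. A number \<open>k\<close> that includes the bounds for \<open>x\<close> and
  \<open>y\<close> is itself the number of some atom, and this atom is in neither set, as otherwise
  \<open>k\<close> would be an element of itself.\<close>

lemma fresh_atom:
  assumes "is_countably_infinite V (atoms V)"
    and "x \<in> univ V" "is_finite V x" "y \<in> univ V" "is_finite V y"
  obtains d where "d \<in> elts V (atoms V)" "d \<notin> elts V x" "d \<notin> elts V y"
proof -
  obtain w g where wg: "w \<in> univ V" "g \<in> univ V" "is_omega V w" "is_bijection V g (atoms V) w"
    using assms(1) unfolding is_countably_infinite_def by blast
  have w: "n \<in> elts V w \<longleftrightarrow> n \<in> univ V \<and> is_natural V n" for n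
    using wg(3) by (auto simp: is_omega_def elts_def)
  have bound: "\<exists>m\<in>univ V. is_natural V m \<and> (\<forall>a\<in>univ V. \<forall>k\<in>univ V. a \<epsilon>\<^bsub>V\<^esub> x \<and> maps_to V g a k \<longrightarrow> k \<epsilon>\<^bsub>V\<^esub> m)"
    if x: "x \<in> univ V" "is_finite V x" for x
  proof -
    have l: "set [g] \<subseteq> univ V" using wg by simp
    have d: "definable 1 [g] (\<lambda>e. \<exists>m\<in>univ V. is_natural V m \<and>
        (\<forall>a\<in>univ V. \<forall>k\<in>univ V. a \<epsilon>\<^bsub>V\<^esub> e 0 \<and> maps_to V g a k \<longrightarrow> k \<epsilon>\<^bsub>V\<^esub> m))"
      by (intro definable_intros) simp_all
    from l d x show ?thesis
    proof (rule finite_induct_definable)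
      fix z assume z: "z \<in> univ V" "is_set V z" "elts V z = {}"
      then show "\<exists>m\<in>univ V. is_natural V m \<and> (\<forall>a\<in>univ V. \<forall>k\<in>univ V. a \<epsilon>\<^bsub>V\<^esub> z \<and> maps_to V g a k \<longrightarrow> k \<epsilon>\<^bsub>V\<^esub> m)"
        using natural_zero[OF z] by (intro bexI[of _ z]) (auto simp: elts_def)
    next
      fix u a v assume uv: "a \<in> elts V x" "elts V v = insert a (elts V u)"
      assume "\<exists>m\<in>univ V. is_natural V m \<and> (\<forall>a\<in>univ V. \<forall>k\<in>univ V. a \<epsilon>\<^bsub>V\<^esub> u \<and> maps_to V g a k \<longrightarrow> k \<epsilon>\<^bsub>V\<^esub> m)"
      then obtain m where m: "m \<in> univ V" "is_natural V m"
        "\<And>a k. a \<in> elts V u \<Longrightarrow> k \<in> univ V \<Longrightarrow> maps_to V g a k \<Longrightarrow> k \<in> elts V m"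
        by (auto simp: elts_def)
      have au: "a \<in> univ V" using uv(1) by (rule elts_univD)
      have fn: "is_function V g (atoms V) w" using wg(4) by (rule bijection_is_function)
      have "\<exists>m'\<in>univ V. is_natural V m' \<and> elts V m \<subseteq> elts V m' \<and> (\<forall>k\<in>univ V. maps_to V g a k \<longrightarrow> k \<in> elts V m')"
      \<comment> \<open>\<open>x\<close> may contain elements that are not atoms; \<open>g\<close>
        has no value there, and the old bound suffices.\<close>
      proof (cases "\<exists>k\<in>univ V. maps_to V g a k")
        case True
        then obtain k where k: "k \<in> univ V" "maps_to V g a k" by blast
        then have kn: "is_natural V k" using function_maps_toD(2)[OF fn k(2) au k(1)] w by simp
        \<comment> \<open>The bound is strict, hence the successor of \<open>k\<close> rather than
          \<open>k\<close>.\<close>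
        obtain s where s: "s \<in> univ V" "elts V s = insert k (elts V k)" using ex_insert[OF k(1) k(1)] .
        have "is_natural V s" using natural_succ[OF k(1) kn s] .
        then obtain m' where "m' \<in> univ V" "is_natural V m'" "elts V m \<subseteq> elts V m'" "elts V s \<subseteq> elts V m'"
          using natural_upper_bound[OF m(1,2) s(1)] by metis
        moreover have "k' = k" if "k' \<in> univ V" "maps_to V g a k'" for k'
          using function_unique[OF fn that(2) k(2) au that(1) k(1)] .
        ultimately show ?thesis using s(2) by blast
      qed (use m in blast)
      then obtain m' where m': "m' \<in> univ V" "is_natural V m'" "elts V m \<subseteq> elts V m'"
        "\<forall>k\<in>univ V. maps_to V g a k \<longrightarrow> k \<in> elts V m'" by blast
      have "k \<in> elts V m'" if "b \<in> elts V v" "k \<in> univ V" "maps_to V g b k" for b k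
        using that m(3)[of b k] m'(3,4) uv(2) by auto
      then show "\<exists>m\<in>univ V. is_natural V m \<and> (\<forall>a\<in>univ V. \<forall>k\<in>univ V. a \<epsilon>\<^bsub>V\<^esub> v \<and> maps_to V g a k \<longrightarrow> k \<epsilon>\<^bsub>V\<^esub> m)"
        using m'(1,2) unfolding elts_def by blast
    qed
  qed
  obtain m where m: "m \<in> univ V" "is_natural V m"
    "\<And>a k. a \<in> elts V x \<Longrightarrow> k \<in> univ V \<Longrightarrow> maps_to V g a k \<Longrightarrow> k \<in> elts V m"
    using bound[OF assms(2,3)] unfolding elts_def by blast
  obtain n where n: "n \<in> univ V" "is_natural V n"
    "\<And>a k. a \<in> elts V y \<Longrightarrow> k \<in> univ V \<Longrightarrow> maps_to V g a k \<Longrightarrow> k \<in> elts V n"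
    using bound[OF assms(4,5)] unfolding elts_def by blast
  obtain k where k: "k \<in> univ V" "is_natural V k" "elts V m \<subseteq> elts V k" "elts V n \<subseteq> elts V k"
    using natural_upper_bound[OF m(1,2) n(1,2)] .
  have "k \<in> elts V w" using w k by simp
  then obtain d where d: "d \<in> elts V (atoms V)" "maps_to V g d k" using bijection_onto[OF wg(4)] by metis
  have "k \<notin> elts V m" "k \<notin> elts V n" using mem_irrefl[OF k(1)] k(3,4) by auto
  then show thesis using that[OF d(1)] m(3)[OF _ k(1) d(2)] n(3)[OF _ k(1) d(2)] by blast
qed

section \<open>The permutation model as a transitive submodel\<close>

lemma atom_not_set: "a \<in> elts V (atoms V) \<Longrightarrow> \<not> is_set V a"
  by (simp add: elts_def is_set_def)

lemma atom_elts: "a \<in> elts V (atoms V) \<Longrightarrow> elts V a = {}"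
  using atom_not_set set_if_elts elts_univD[of a V "atoms V"] by blast

text \<open>A transitive set whose atoms lie in \<open>E\<close>: all of its elements are supported by \<open>E\<close>.\<close>

definition supported :: "'u \<Rightarrow> 'u \<Rightarrow> bool" where
  "supported E T \<longleftrightarrow> T \<in> univ V \<and> is_transitive V T \<and> elts V T \<inter> elts V (atoms V) \<subseteq> elts V E"

text \<open>Only sets are added, so no new atoms appear, and their elements lie in \<open>T\<close>,
  which keeps the result transitive.\<close>

lemma supported_Pow:
  assumes "supported E T"
  obtains T' where "supported E T'" "elts V T' = elts V T \<union> {x \<in> univ V. is_set V x \<and> elts V x \<subseteq> elts V T}"
proof -
  have T: "T \<in> univ V" "is_set V T" "\<And>y. y \<in> elts V T \<Longrightarrow> elts V y \<subseteq> elts V T"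
    using assms by (auto simp: supported_def is_transitive_iff)
  obtain p where p: "p \<in> univ V" "elts V p = {x \<in> univ V. is_set V x \<and> elts V x \<subseteq> elts V T}"
    using ex_Pow[OF T(1,2)] by metis
  obtain T' where T': "T' \<in> univ V" "is_set V T'" "elts V T' = elts V T \<union> elts V p"
    using ex_Un[OF T(1) p(1)] .
  have "is_transitive V T'" using T(3) T' p(2) unfolding is_transitive_iff by auto
  moreover have "elts V T' \<inter> elts V (atoms V) \<subseteq> elts V E"
    using assms atom_not_set unfolding T' p supported_def by auto
  ultimately show thesis using that T' p by (simp add: supported_def)
qed

lemma supported_Un:
  assumes "supported E T" "supported E U"
  obtains W where "supported E W" "elts V W = elts V T \<union> elts V U"
proof -
  have "T \<in> univ V" "U \<in> univ V" using assms by (auto simp: supported_def)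
  then obtain W where "W \<in> univ V" "is_set V W" "elts V W = elts V T \<union> elts V U"
    using ex_Un by metis
  moreover from this have "supported E W"
    using assms unfolding supported_def is_transitive_iff by auto
  ultimately show thesis using that by blast
qed

text \<open>All elements of an ordinal are transitive sets, hence not atoms, so any \<open>E\<close>
  will do. Joining a number to a supported set therefore costs no support.\<close>

lemma supported_natural: "n \<in> univ V \<Longrightarrow> is_natural V n \<Longrightarrow> supported E n"
  unfolding supported_def is_natural_iff using atom_not_set by (auto simp: is_transitive_iff)

text \<open>Atoms have no elements, so a set of atoms is transitive. It is the ground level above
  which power-set steps are taken.\<close>

lemma supported_atoms: "E \<in> univ V \<Longrightarrow> is_subset V E (atoms V) \<Longrightarrow> supported E E"
  using atom_elts by (auto simp: supported_def is_transitive_iff is_subset_iff)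

text \<open>The recursion equations for \<open>\<pi>\<close> hold for the identity on \<open>T\<close>.\<close>

lemma perm_image_supported:
  assumes "supported E T" "x \<in> elts V T" "\<pi> \<in> pointwise_stabilizer V E"
  shows "perm_image V \<pi> x x"
proof -
  have T: "T \<in> univ V" "is_transitive V T" "is_set V T" "\<And>y. y \<in> elts V T \<Longrightarrow> elts V y \<subseteq> elts V T"
    "elts V T \<inter> elts V (atoms V) \<subseteq> elts V E"
    using assms(1) by (auto simp: supported_def is_transitive_iff)
  have \<pi>: "maps_to V \<pi> a a" if "a \<in> elts V E" for a
    using assms(3) that by (auto simp: pointwise_stabilizer_def elts_def)
  have l: "set [T] \<subseteq> univ V" "T \<in> set [T]" using T by auto
  have d: "definable (Suc (Suc 1)) [T] (\<lambda>e. e (Suc 0) = e 0)" by (intro definable_intros)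
  obtain f where f: "f \<in> univ V" "is_bijection V f T T"
    "\<And>a b. a \<in> univ V \<Longrightarrow> b \<in> univ V \<Longrightarrow> maps_to V f a b \<longleftrightarrow> a \<in> elts V T \<and> b \<in> elts V T \<and> a = b"
    by (rule ex_bijection[where R = "(=)", OF T(1,1,3,3) l l(2) d]) blast+
  have "extends_perm V \<pi> T f"
    unfolding extends_perm_def
  proof (intro conjI ballI impI)
    show "\<exists>r\<in>univ V. is_function V f T r" using bijection_is_function[OF f(2)] T(1) by blast
    fix x y assume "x \<in> univ V" "y \<in> univ V" "x \<epsilon>\<^bsub>V\<^esub> T \<and> maps_to V f x y"
    then have x: "y = x" "x \<in> univ V" "x \<in> elts V T" using f(3) by (auto simp: elts_def)
    have "maps_to V \<pi> x x" if "x \<epsilon>\<^bsub>V\<^esub> atoms V" using that x \<pi>[of x] T(5) by (auto simp: elts_def)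
    moreover have "v \<epsilon>\<^bsub>V\<^esub> x \<longleftrightarrow> (\<exists>u\<in>univ V. u \<epsilon>\<^bsub>V\<^esub> x \<and> maps_to V f u v)" if "v \<in> univ V" for v
      using that f(3) T(4)[OF x(3)] by (auto simp: elts_def)
    ultimately show "if x \<epsilon>\<^bsub>V\<^esub> atoms V then maps_to V \<pi> x y
      else is_set V y \<and> (\<forall>v\<in>univ V. v \<epsilon>\<^bsub>V\<^esub> y \<longleftrightarrow> (\<exists>u\<in>univ V. u \<epsilon>\<^bsub>V\<^esub> x \<and> maps_to V f u v))"
      using x(1) by (simp add: is_set_def)
  qed
  moreover have "maps_to V f x x" using f(3) assms(2) elts_univD[OF assms(2)] by simp
  ultimately show ?thesis
    using T(1,2) f(1) assms(2) unfolding perm_image_def elts_def by blast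
qed

section \<open>Hereditarily symmetric sets form a transitive class\<close>

abbreviation N :: "'u zfa_structure" where
  "N \<equiv> first_fraenkel_model V"

lemma mem_N [simp]: "mem N = mem V"
  and atoms_N [simp]: "atoms N = atoms V"
  and univ_N: "univ N = {x \<in> univ V. hereditarily_symmetric V x}"
  by (simp_all add: first_fraenkel_model_def)

lemma univ_N_subset: "x \<in> univ N \<Longrightarrow> x \<in> univ V"
  by (simp add: univ_N)

lemma is_set_N [simp]: "is_set N x \<longleftrightarrow> is_set V x"
  by (simp add: is_set_def)

lemma in_trans_closure_refl: "in_trans_closure V x x"
  by (simp add: in_trans_closure_def)

lemma in_trans_closure_mem_left:
  "in_trans_closure V y z \<Longrightarrow> y \<in> elts V x \<Longrightarrow> x \<in> univ V \<Longrightarrow> in_trans_closure V x z"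
  unfolding in_trans_closure_def is_transitive_def elts_def by blast

lemma in_trans_closure_mem_right:
  "in_trans_closure V x y \<Longrightarrow> z \<in> elts V y \<Longrightarrow> y \<in> univ V \<Longrightarrow> in_trans_closure V x z"
  unfolding in_trans_closure_def is_transitive_def elts_def by blast

lemma univ_N_transitive: "x \<in> univ N \<Longrightarrow> y \<in> elts V x \<Longrightarrow> y \<in> univ N"
  using in_trans_closure_mem_left[of y _ x] elts_univD[of y V x]
  by (auto simp: univ_N hereditarily_symmetric_def)

lemma elts_N [simp]: "x \<in> univ N \<Longrightarrow> elts N x = elts V x"
  using univ_N_transitive[of x] univ_N_subset by (auto simp: elts_def)

text \<open>\<open>T\<close> bounds the transitive closure of each of its elements, so the single
  support \<open>E\<close> serves for everything that occurs there.\<close>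

lemma supported_subset_N:
  assumes "supported E T" "E \<in> univ V" "is_subset V E (atoms V)" "is_finite V E"
  shows "elts V T \<subseteq> univ N"
proof
  fix x assume x: "x \<in> elts V T"
  have T: "T \<in> univ V" "is_transitive V T" using assms(1) by (auto simp: supported_def)
  have "is_symmetric V z" if "z \<in> univ V" "in_trans_closure V x z" for z
  proof -
    have "z \<in> elts V T" using that T x by (auto simp: in_trans_closure_def elts_def)
    then have "pointwise_stabilizer V E \<subseteq> stabilizer V z"
      using perm_image_supported[OF assms(1)] by (auto simp: stabilizer_def pointwise_stabilizer_def)
    then show ?thesis using assms(2-4) unfolding is_symmetric_def by blast
  qed
  then show "x \<in> univ N" using elts_univD[OF x] by (simp add: univ_N hereditarily_symmetric_def)
qed

text \<open>Meant for sets whose transitive closure contains all atoms, where no finite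
  \<open>E\<close> supports all members of the closure at once. The closure of \<open>x\<close>
  consists of \<open>x\<close> and the closures of its elements, so beyond the elements only
  symmetry of \<open>x\<close> itself is at stake; \<open>t\<close> provides a set from which this
  closure is separated.\<close>

lemma univ_N_intro:
  assumes "x \<in> univ V" "elts V x \<subseteq> univ N" "is_symmetric V x"
    and t: "t \<in> univ V" "is_transitive V t" "x \<in> elts V t"
  shows "x \<in> univ N"
proof -
  have l: "set [x] \<subseteq> univ V" using assms by simp
  have d: "definable 1 [x] (\<lambda>e. e 0 = x \<or> (\<exists>y\<in>univ V. y \<epsilon>\<^bsub>V\<^esub> x \<and> in_trans_closure V y (e 0)))"
    by (intro definable_intros) simp_all
  obtain u where u: "u \<in> univ V" "is_set V u"
    "elts V u = {w \<in> elts V t. w = x \<or> (\<exists>y\<in>univ V. y \<epsilon>\<^bsub>V\<^esub> x \<and> in_trans_closure V y w)}"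
    using separation_definable[where Q = "\<lambda>w. w = x \<or> (\<exists>y\<in>univ V. y \<epsilon>\<^bsub>V\<^esub> x \<and> in_trans_closure V y w)", OF t(1) l d] .
  have "is_transitive V u"
    unfolding is_transitive_iff
  proof (intro conjI ballI subsetI)
    fix w v assume w: "w \<in> elts V u" and v: "v \<in> elts V w"
    have wt: "w \<in> elts V t" using w u(3) by simp
    have "v \<in> elts V t" using v t(2) wt by (auto simp: is_transitive_iff)
    moreover have "\<exists>y\<in>univ V. y \<epsilon>\<^bsub>V\<^esub> x \<and> in_trans_closure V y v"
    proof (cases "w = x")
      case True
      then show ?thesis using v in_trans_closure_refl by (auto simp: elts_def)
    next
      case False
      then obtain y where "y \<in> univ V" "y \<epsilon>\<^bsub>V\<^esub> x" "in_trans_closure V y w" using w u(3) by auto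
      then show ?thesis using in_trans_closure_mem_right[OF _ v elts_univD[OF wt]] by blast
    qed
    ultimately show "v \<in> elts V u" using u(3) by simp
  qed (rule u(2))
  moreover have "x \<in> elts V u" using u t by simp
  ultimately have *: "z \<in> elts V u" if "z \<in> univ V" "in_trans_closure V x z" for z
    using that u(1) by (auto simp: in_trans_closure_def elts_def)
  have "is_symmetric V z" if z: "z \<in> univ V" "in_trans_closure V x z" for z
  proof (cases "z = x")
    case False
    then obtain y where y: "y \<in> univ V" "y \<epsilon>\<^bsub>V\<^esub> x" "in_trans_closure V y z" using *[OF z] u(3) by auto
    then have "y \<in> univ N" using assms(2) by (auto simp: elts_def)
    then show ?thesis using y(3) z(1) by (auto simp: univ_N hereditarily_symmetric_def)
  qed (use assms in simp)
  then show ?thesis using assms(1) by (simp add: univ_N hereditarily_symmetric_def)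
qed

section \<open>Absoluteness of pairs, functions, numbers and finiteness\<close>

lemma is_opair_N:
  assumes "a \<in> univ N" "b \<in> univ N" "p \<in> univ N"
  shows "is_opair N a b p \<longleftrightarrow> is_opair V a b p"
proof
  assume "is_opair N a b p"
  then obtain u v where "u \<in> univ N" "v \<in> univ N" "elts V u = {a}" "elts V v = {a, b}" "elts V p = {u, v}"
    using assms by (auto simp: is_opair_iff)
  then show "is_opair V a b p" using assms univ_N_subset unfolding is_opair_iff[OF assms(1,2)[THEN univ_N_subset]] by blast
next
  assume "is_opair V a b p"
  then obtain u v where uv: "elts V u = {a}" "elts V v = {a, b}" "elts V p = {u, v}"
    using assms is_opair_iff[OF assms(1,2)[THEN univ_N_subset]] by blast
  moreover have "u \<in> univ N" "v \<in> univ N" using univ_N_transitive[OF assms(3)] uv(3) by auto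
  ultimately show "is_opair N a b p" using assms unfolding is_opair_iff[OF assms(1,2)] by auto
qed

text \<open>The components are elements of an element of the pair, so transitivity of the model
  catches them. This brings arguments and values of functions, quantified over \<open>V\<close>,
  back into \<open>N\<close>.\<close>

lemma opair_N_components:
  assumes "p \<in> univ N" "is_opair V a b p" "a \<in> univ V" "b \<in> univ V"
  shows "a \<in> univ N" "b \<in> univ N"
proof -
  obtain u v where uv: "elts V u = {a}" "elts V v = {a, b}" "elts V p = {u, v}"
    using assms is_opair_iff[OF assms(3,4)] by blast
  have "v \<in> univ N" using univ_N_transitive[OF assms(1)] uv(3) by auto
  then show "a \<in> univ N" "b \<in> univ N" using univ_N_transitive[of v] uv(2) by auto
qed

lemma maps_to_N:
  assumes "f \<in> univ N" "a \<in> univ N" "b \<in> univ N"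
  shows "maps_to N f a b \<longleftrightarrow> maps_to V f a b"
  using assms is_opair_N univ_N_transitive[OF assms(1)] by (auto simp: maps_to_iff)

lemma is_function_N:
  assumes "f \<in> univ N" "x \<in> univ N" "y \<in> univ N"
  shows "is_function N f x y \<longleftrightarrow> is_function V f x y"
proof -
  have "(\<exists>a\<in>elts V x. \<exists>b\<in>elts V y. is_opair N a b p) \<longleftrightarrow> (\<exists>a\<in>elts V x. \<exists>b\<in>elts V y. is_opair V a b p)"
    if p: "p \<in> elts V f" for p
    using is_opair_N[OF _ _ univ_N_transitive[OF assms(1) p]] univ_N_transitive[OF assms(2)]
      univ_N_transitive[OF assms(3)] by auto
  moreover have "(b \<in> univ N \<and> maps_to N f a b) \<longleftrightarrow> (b \<in> univ V \<and> maps_to V f a b)" if a: "a \<in> elts V x" for a b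
  proof
    assume "b \<in> univ N \<and> maps_to N f a b"
    then show "b \<in> univ V \<and> maps_to V f a b"
      using maps_to_N[OF assms(1) univ_N_transitive[OF assms(2) a]] univ_N_subset by auto
  next
    assume b: "b \<in> univ V \<and> maps_to V f a b"
    then obtain p where p: "p \<in> elts V f" "is_opair V a b p" by (auto simp: maps_to_iff)
    have "b \<in> univ N"
      using opair_N_components(2)[OF univ_N_transitive[OF assms(1) p(1)] p(2) elts_univD[OF a]] b by simp
    then show "b \<in> univ N \<and> maps_to N f a b"
      using b maps_to_N[OF assms(1) univ_N_transitive[OF assms(2) a]] by simp
  qed
  ultimately show ?thesis using assms by (simp add: is_function_iff)
qed

lemma is_bijection_N:
  assumes "f \<in> univ N" "x \<in> univ N" "y \<in> univ N"
  shows "is_bijection N f x y \<longleftrightarrow> is_bijection V f x y"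
proof -
  have "(a \<in> univ N \<and> maps_to N f a b) \<longleftrightarrow> (a \<in> univ V \<and> maps_to V f a b)" if b: "b \<in> elts V y" for a b
  proof
    assume "a \<in> univ N \<and> maps_to N f a b"
    then show "a \<in> univ V \<and> maps_to V f a b"
      using maps_to_N[OF assms(1) _ univ_N_transitive[OF assms(3) b]] univ_N_subset by auto
  next
    assume a: "a \<in> univ V \<and> maps_to V f a b"
    then obtain p where p: "p \<in> elts V f" "is_opair V a b p" by (auto simp: maps_to_iff)
    have "a \<in> univ N"
      using opair_N_components(1)[OF univ_N_transitive[OF assms(1) p(1)] p(2) _ elts_univD[OF b]] a by simp
    then show "a \<in> univ N \<and> maps_to N f a b"
      using a maps_to_N[OF assms(1) _ univ_N_transitive[OF assms(3) b]] by simp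
  qed
  then show ?thesis using assms by (simp add: is_bijection_iff is_function_N)
qed

text \<open>The one quantifier not bounded by \<open>n\<close>, over the predecessor of
  \<open>m\<close>, has its witness inside \<open>m\<close>.\<close>

lemma is_natural_N:
  assumes "n \<in> univ N"
  shows "is_natural N n \<longleftrightarrow> is_natural V n"
proof -
  have t: "is_transitive N m \<longleftrightarrow> is_transitive V m" if "m \<in> univ N" for m
    using that univ_N_transitive[OF that] by (simp add: is_transitive_iff)
  have s: "(\<exists>k\<in>univ N. is_succ N k m) \<longleftrightarrow> (\<exists>k\<in>univ V. is_succ V k m)" if m: "m \<in> univ N" for m
  proof
    assume "\<exists>k\<in>univ N. is_succ N k m"
    then show "\<exists>k\<in>univ V. is_succ V k m" using m univ_N_subset by (auto simp: is_succ_iff)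
  next
    assume "\<exists>k\<in>univ V. is_succ V k m"
    then obtain k where k: "elts V m = insert k (elts V k)" by (auto simp: is_succ_iff)
    then have "k \<in> univ N" using univ_N_transitive[OF m] by blast
    then show "\<exists>k\<in>univ N. is_succ N k m" using k m by (auto simp: is_succ_iff)
  qed
  show ?thesis
    using assms univ_N_transitive[OF assms]
    by (auto simp: is_natural_iff univ_N_subset t s is_empty_iff)
qed

lemma finite_if_finite_N:
  assumes "x \<in> univ N" "is_finite N x"
  shows "is_finite V x"
proof -
  obtain n f where "n \<in> univ N" "f \<in> univ N" "is_natural N n" "is_bijection N f x n"
    using assms unfolding is_finite_def by blast
  then show ?thesis
    using assms univ_N_subset is_natural_N is_bijection_N unfolding is_finite_def is_set_N by blast
qed

text \<open>The bijection \<open>f\<close> itself must be in the model. Its pairs lie two power-set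
  steps above \<open>T \<union> n\<close> and \<open>f\<close> lies one step further; since numbers
  contain no atoms, all of this is still supported by \<open>E\<close>.\<close>

lemma finite_N_if_finite:
  assumes "supported E T" "E \<in> univ V" "is_subset V E (atoms V)" "is_finite V E"
    and "x \<in> elts V T" "is_finite V x"
  shows "is_finite N x"
proof -
  obtain n f where nf: "n \<in> univ V" "f \<in> univ V" "is_natural V n" "is_bijection V f x n"
    using assms(6) unfolding is_finite_def by blast
  have fn: "is_function V f x n" using nf(4) by (rule bijection_is_function)
  obtain U where U: "supported E U" "elts V U = elts V T \<union> elts V n"
    using supported_Un[OF assms(1) supported_natural[OF nf(1,3)]] .
  obtain U1 where U1: "supported E U1" "elts V U1 = elts V U \<union> {x \<in> univ V. is_set V x \<and> elts V x \<subseteq> elts V U}"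
    using supported_Pow[OF U(1)] .
  obtain U2 where U2: "supported E U2" "elts V U2 = elts V U1 \<union> {x \<in> univ V. is_set V x \<and> elts V x \<subseteq> elts V U1}"
    using supported_Pow[OF U1(1)] .
  obtain U3 where U3: "supported E U3" "elts V U3 = elts V U2 \<union> {x \<in> univ V. is_set V x \<and> elts V x \<subseteq> elts V U2}"
    using supported_Pow[OF U2(1)] .
  have xT: "elts V x \<subseteq> elts V T" using assms(1,5) by (auto simp: supported_def is_transitive_iff)
  have "p \<in> elts V U2" if p: "p \<in> elts V f" for p
  proof -
    have pu: "p \<in> univ V" using p by (rule elts_univD)
    obtain a b where ab: "a \<in> elts V x" "b \<in> elts V n" "is_opair V a b p"
      using fn p unfolding is_function_iff by blast
    have abu: "a \<in> univ V" "b \<in> univ V" using ab(1,2)[THEN elts_univD] .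
    obtain u v where uv: "u \<in> univ V" "v \<in> univ V" "elts V u = {a}" "elts V v = {a, b}" "elts V p = {u, v}"
      using ab(3) is_opair_iff[OF abu] by blast
    have "u \<in> elts V U1" "v \<in> elts V U1"
      using uv ab xT set_if_elts[of u a] set_if_elts[of v a] unfolding U1 U by auto
    then show ?thesis using uv opair_set[OF ab(3) abu pu] pu unfolding U2 by auto
  qed
  then have "f \<in> elts V U3" using nf(2) fn unfolding U3 is_function_iff by auto
  moreover have "n \<in> elts V U1" unfolding U1 U using natural_set[OF nf(1,3)] nf(1) by auto
  then have "n \<in> elts V U3" unfolding U2 U3 by simp
  moreover have "x \<in> elts V U3" using assms(5) unfolding U3 U2 U1 U by simp
  ultimately have "f \<in> univ N" "n \<in> univ N" "x \<in> univ N"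
    using supported_subset_N[OF U3(1) assms(2-4)] by auto
  then show ?thesis
    using nf assms(6) is_natural_N is_bijection_N finite_set[OF assms(6)] unfolding is_finite_def is_set_N by blast
qed

text \<open>The cumulative hierarchy over \<open>X\<close>, indexed by the \<open>nat\<close> of the
  metatheory: the power-set steps are iterated outside \<open>V\<close>, and only small fixed levels
  matter. Cumulativity allows objects of different rank to be placed on a common level.\<close>

primrec level :: "'u set \<Rightarrow> nat \<Rightarrow> 'u set" where
  "level X 0 = X"
| "level X (Suc n) = level X n \<union> {x \<in> univ V. is_set V x \<and> elts V x \<subseteq> level X n}"

lemma level_mono: "m \<le> n \<Longrightarrow> level X m \<subseteq> level X n"
  by (rule lift_Suc_mono_le[of "level X"]) auto

lemma level_SucI: "x \<in> univ V \<Longrightarrow> is_set V x \<Longrightarrow> elts V x \<subseteq> level X n \<Longrightarrow> x \<in> level X (Suc n)"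
  by simp

lemma opair_level:
  assumes "is_opair V a b p" "a \<in> level X n" "b \<in> level X n" "a \<in> univ V" "b \<in> univ V" "p \<in> univ V"
  shows "p \<in> level X (Suc (Suc n))"
proof -
  obtain u v where uv: "u \<in> univ V" "v \<in> univ V" "elts V u = {a}" "elts V v = {a, b}" "elts V p = {u, v}"
    using assms(1) is_opair_iff[OF assms(4,5)] by blast
  have "u \<in> level X (Suc n)" "v \<in> level X (Suc n)"
    using uv assms(2,3) set_if_elts[of u a] set_if_elts[of v a] by (auto intro!: level_SucI simp del: level.simps)
  then show ?thesis
    using uv assms(6) opair_set[OF assms(1,4-6)] by (intro level_SucI) (auto simp del: level.simps)
qed

lemma supported_level:
  assumes "supported E T"
  obtains T' where "supported E T'" "elts V T' = level (elts V T) n"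
proof -
  have "\<exists>T'. supported E T' \<and> elts V T' = level (elts V T) n"
  proof (induction n)
    case (Suc n)
    then obtain T' where T': "supported E T'" "elts V T' = level (elts V T) n" by blast
    obtain T'' where "supported E T''"
      "elts V T'' = elts V T' \<union> {x \<in> univ V. is_set V x \<and> elts V x \<subseteq> elts V T'}"
      using supported_Pow[OF T'(1)] .
    then show ?case using T'(2) by auto
  qed (use assms in auto)
  then show thesis using that by blast
qed

section \<open>The action of permutations of the atoms\<close>

text \<open>By foundation: if the set of atoms were an atom, it would be an element of
  itself.\<close>

lemma atoms_set: "is_set V (atoms V)"
  using mem_irrefl[OF atoms_in_univ] atoms_in_univ by (simp add: is_set_elts_iff)

text \<open>\<open>H\<close> is the restriction to the transitive set \<open>T\<close> of the action of \<open>\<pi>\<close>.\<close>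

definition acts :: "'u \<Rightarrow> 'u \<Rightarrow> ('u \<Rightarrow> 'u) \<Rightarrow> bool" where
  "acts \<pi> T H \<longleftrightarrow> T \<in> univ V \<and> is_transitive V T \<and> elts V (atoms V) \<subseteq> elts V T \<and>
     bij_betw H (elts V T) (elts V T) \<and>
     (\<exists>h\<in>univ V. is_function V h T T \<and>
        (\<forall>a\<in>univ V. \<forall>b\<in>univ V. maps_to V h a b \<longleftrightarrow> a \<in> elts V T \<and> b = H a)) \<and>
     (\<forall>a\<in>elts V (atoms V). maps_to V \<pi> a (H a)) \<and>
     (\<forall>x\<in>elts V T. is_set V x \<longrightarrow> is_set V (H x) \<and> elts V (H x) = H ` elts V x)"

text \<open>\<open>T\<close> and the internal function \<open>h\<close> are precisely a witness of
  the membership recursion behind \<open>perm_image\<close>.\<close>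

lemma acts_perm_image:
  assumes "acts \<pi> T H" "x \<in> elts V T" "H x = x"
  shows "perm_image V \<pi> x x"
proof -
  have T: "T \<in> univ V" "is_transitive V T" "\<And>y. y \<in> elts V T \<Longrightarrow> elts V y \<subseteq> elts V T"
    using assms(1) by (auto simp: acts_def is_transitive_iff)
  have at: "\<And>a. a \<in> elts V (atoms V) \<Longrightarrow> maps_to V \<pi> a (H a)"
    and st: "\<And>x. x \<in> elts V T \<Longrightarrow> is_set V x \<Longrightarrow> is_set V (H x) \<and> elts V (H x) = H ` elts V x"
    using assms(1) by (auto simp: acts_def)
  obtain h where h: "h \<in> univ V" "is_function V h T T"
    "\<And>a b. a \<in> univ V \<Longrightarrow> b \<in> univ V \<Longrightarrow> maps_to V h a b \<longleftrightarrow> a \<in> elts V T \<and> b = H a"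
    using assms(1) unfolding acts_def by auto
  have "extends_perm V \<pi> T h"
    unfolding extends_perm_def
  proof (intro conjI ballI impI)
    show "\<exists>r\<in>univ V. is_function V h T r" using h(2) T(1) by blast
    fix x y assume xy: "x \<in> univ V" "y \<in> univ V" "x \<epsilon>\<^bsub>V\<^esub> T \<and> maps_to V h x y"
    then have x: "y = H x" "x \<in> elts V T" using h(3) by (auto simp: elts_def)
    have "maps_to V \<pi> x y" if "x \<epsilon>\<^bsub>V\<^esub> atoms V" using that x(1) at xy(1) by (simp add: mem_elts_iff)
    moreover have "is_set V y \<and> (\<forall>v\<in>univ V. v \<epsilon>\<^bsub>V\<^esub> y \<longleftrightarrow> (\<exists>u\<in>univ V. u \<epsilon>\<^bsub>V\<^esub> x \<and> maps_to V h u v))"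
      if "\<not> x \<epsilon>\<^bsub>V\<^esub> atoms V"
    proof (intro conjI ballI)
      have s: "is_set V x" using that by (simp add: is_set_def)
      show "is_set V y" using st[OF x(2) s] x(1) by simp
      fix v assume v: "v \<in> univ V"
      have "v \<in> elts V y \<longleftrightarrow> (\<exists>u\<in>elts V x. v = H u)" using st[OF x(2) s] x(1) by auto
      also have "\<dots> \<longleftrightarrow> (\<exists>u\<in>elts V x. maps_to V h u v)"
        using h(3)[OF _ v] T(3)[OF x(2)] elts_univD[of _ V x] by auto
      finally show "v \<epsilon>\<^bsub>V\<^esub> y \<longleftrightarrow> (\<exists>u\<in>univ V. u \<epsilon>\<^bsub>V\<^esub> x \<and> maps_to V h u v)"
        using v by (auto simp: elts_def)
    qed
    ultimately show "if x \<epsilon>\<^bsub>V\<^esub> atoms V then maps_to V \<pi> x y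
      else is_set V y \<and> (\<forall>v\<in>univ V. v \<epsilon>\<^bsub>V\<^esub> y \<longleftrightarrow> (\<exists>u\<in>univ V. u \<epsilon>\<^bsub>V\<^esub> x \<and> maps_to V h u v))"
      by simp
  qed
  moreover have "maps_to V h x x" using h(3) assms(2,3) elts_univD[OF assms(2)] by simp
  ultimately show ?thesis
    using T(1,2) h(1) assms(2) unfolding perm_image_def elts_def by blast
qed

text \<open>Ground case: no element of the set of atoms is a set, so the clause about sets is
  vacuous, and \<open>\<pi>\<close> itself serves as the internal function.\<close>

lemma acts_atoms:
  assumes "\<pi> \<in> atom_perms V"
  obtains H where "acts \<pi> (atoms V) H"
proof -
  let ?A = "atoms V"
  have p: "\<pi> \<in> univ V" "is_bijection V \<pi> ?A ?A" using assms by (simp_all add: atom_perms_def)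
  have fn: "is_function V \<pi> ?A ?A" using p(2) by (rule bijection_is_function)
  define H where "H a = (SOME b. b \<in> elts V ?A \<and> maps_to V \<pi> a b)" for a
  have H: "H a \<in> elts V ?A" "maps_to V \<pi> a (H a)" if "a \<in> elts V ?A" for a
  proof -
    have "\<exists>b. b \<in> elts V ?A \<and> maps_to V \<pi> a b" using function_total[OF fn that] by metis
    then show "H a \<in> elts V ?A" "maps_to V \<pi> a (H a)" unfolding H_def by (metis (mono_tags, lifting) someI_ex)+
  qed
  have iff: "maps_to V \<pi> a b \<longleftrightarrow> a \<in> elts V ?A \<and> b = H a" if "a \<in> univ V" "b \<in> univ V" for a b
    using function_maps_toD[OF fn _ that] function_unique[OF fn _ _ that(1)] H[of a] that(2)
      elts_univD[of "H a" V ?A] by metis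
  have "inj_on H (elts V ?A)"
    using bijection_inject[OF p(2)] H by (intro inj_onI) (metis elts_univD)
  moreover have "elts V ?A \<subseteq> H ` elts V ?A"
  proof
    fix b assume b: "b \<in> elts V ?A"
    obtain a where a: "a \<in> elts V ?A" "maps_to V \<pi> a b" using bijection_onto[OF p(2) b] .
    then show "b \<in> H ` elts V ?A" using iff[OF elts_univD[OF a(1)] elts_univD[OF b]] by blast
  qed
  ultimately have "bij_betw H (elts V ?A) (elts V ?A)" using H(1) by (auto simp: bij_betw_def)
  moreover have "is_transitive V ?A" using atoms_set atom_elts by (simp add: is_transitive_iff)
  ultimately have "acts \<pi> ?A H"
    using H(2) iff fn p(1) atoms_in_univ atom_not_set unfolding acts_def by blast
  then show thesis by (rule that)
qed

lemma acts_atom_iff: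
  assumes "\<pi> \<in> atom_perms V" "acts \<pi> T H" "x \<in> elts V T"
  shows "H x \<in> elts V (atoms V) \<longleftrightarrow> x \<in> elts V (atoms V)"
proof
  have Hx: "H x \<in> univ V" using assms(2,3) elts_univD[of "H x" V T] unfolding acts_def by (auto dest: bij_betwE)
  have fn: "is_function V \<pi> (atoms V) (atoms V)"
    using assms(1) bijection_is_function[of V \<pi>] by (simp add: atom_perms_def)
  assume "x \<in> elts V (atoms V)"
  then have "maps_to V \<pi> x (H x)" using assms(2) by (simp add: acts_def)
  then show "H x \<in> elts V (atoms V)" using function_maps_toD(2)[OF fn _ elts_univD[OF assms(3)] Hx] by simp
next
  assume "H x \<in> elts V (atoms V)"
  then have "\<not> is_set V x" using assms(2,3) atom_not_set by (auto simp: acts_def)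
  then show "x \<in> elts V (atoms V)" using is_set_elts_iff[OF elts_univD[OF assms(3)]] by simp
qed

text \<open>One step of the recursion: a subset of \<open>T\<close> goes to its image under
  \<open>H\<close>. Bijectivity of \<open>H\<close> passes to the image map on subsets, and on sets
  that already were in \<open>T\<close> both maps agree by extensionality.\<close>

lemma acts_Pow:
  assumes "\<pi> \<in> atom_perms V" "acts \<pi> T H"
  obtains T' H' where "acts \<pi> T' H'"
    "elts V T' = elts V T \<union> {x \<in> univ V. is_set V x \<and> elts V x \<subseteq> elts V T}"
proof -
  let ?A = "atoms V"
  have T: "T \<in> univ V" "is_transitive V T" "\<And>y. y \<in> elts V T \<Longrightarrow> elts V y \<subseteq> elts V T"
    and AT: "elts V ?A \<subseteq> elts V T"
    and bij: "bij_betw H (elts V T) (elts V T)"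
    using assms(2) by (auto simp: acts_def is_transitive_iff)
  have at: "\<And>a. a \<in> elts V (atoms V) \<Longrightarrow> maps_to V \<pi> a (H a)"
    and st: "\<And>x. x \<in> elts V T \<Longrightarrow> is_set V x \<Longrightarrow> is_set V (H x) \<and> elts V (H x) = H ` elts V x"
    using assms(2) by (auto simp: acts_def)
  have HT: "H u \<in> elts V T" if "u \<in> elts V T" for u using bij that by (auto dest: bij_betwE)
  have inj: "inj_on H (elts V T)" and sur: "H ` elts V T = elts V T" using bij by (auto simp: bij_betw_def)
  obtain h where h: "h \<in> univ V" "is_function V h T T"
    "\<And>a b. a \<in> univ V \<Longrightarrow> b \<in> univ V \<Longrightarrow> maps_to V h a b \<longleftrightarrow> a \<in> elts V T \<and> b = H a"
    using assms(2) unfolding acts_def by auto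
  have p: "\<pi> \<in> univ V" "is_bijection V \<pi> ?A ?A" using assms(1) by (simp_all add: atom_perms_def)
  have fn: "is_function V \<pi> ?A ?A" using p(2) by (rule bijection_is_function)
  have sup: "supported (atoms V) T" using T AT by (simp add: supported_def)
  obtain T' where T': "supported (atoms V) T'"
    "elts V T' = elts V T \<union> {x \<in> univ V. is_set V x \<and> elts V x \<subseteq> elts V T}"
    using supported_Pow[OF sup] .
  have T'u: "T' \<in> univ V" "is_transitive V T'" "is_set V T'"
    using T'(1) by (auto simp: supported_def is_transitive_iff)
  have T'set: "elts V x \<subseteq> elts V T" if "x \<in> elts V T'" for x using that T(3) unfolding T'(2) by auto
  have T'atom: "x \<in> elts V ?A" if "x \<in> elts V T'" "\<not> is_set V x" for x
    using that is_set_elts_iff[OF elts_univD[OF that(1)]] by simp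

  \<comment> \<open>The image has to be an element of \<open>V\<close>, so it is picked by
    \<open>SOME\<close>. It exists by separation from \<open>T\<close> with parameter
    \<open>h\<close>, the internal version of \<open>H\<close>.\<close>
  define H' where "H' x = (if is_set V x then SOME y. y \<in> univ V \<and> is_set V y \<and> elts V y = H ` elts V x else H x)" for x
  have H'set: "H' x \<in> univ V" "is_set V (H' x)" "elts V (H' x) = H ` elts V x"
    if x: "x \<in> elts V T'" "is_set V x" for x
  proof -
    have l: "set [x, h] \<subseteq> univ V" using x h(1) elts_univD[OF x(1)] by simp
    have d: "definable 1 [x, h] (\<lambda>e. \<exists>u\<in>univ V. u \<epsilon>\<^bsub>V\<^esub> x \<and> maps_to V h u (e 0))"
      by (intro definable_intros) simp_all
    obtain y where y: "y \<in> univ V" "is_set V y"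
      "elts V y = {v \<in> elts V T. \<exists>u\<in>univ V. u \<epsilon>\<^bsub>V\<^esub> x \<and> maps_to V h u v}"
      using separation_definable[where Q = "\<lambda>v. \<exists>u\<in>univ V. u \<epsilon>\<^bsub>V\<^esub> x \<and> maps_to V h u v", OF T(1) l d] .
    have "(\<exists>u\<in>univ V. u \<epsilon>\<^bsub>V\<^esub> x \<and> maps_to V h u v) \<longleftrightarrow> (\<exists>u\<in>elts V x. v = H u)" if v: "v \<in> elts V T" for v
      using h(3)[OF _ elts_univD[OF v]] T'set[OF x(1)] by (auto simp: elts_def)
    then have "elts V y = H ` elts V x" using HT T'set[OF x(1)] unfolding y(3) by auto
    then have "\<exists>y. y \<in> univ V \<and> is_set V y \<and> elts V y = H ` elts V x" using y by blast
    from someI_ex[OF this] show "H' x \<in> univ V" "is_set V (H' x)" "elts V (H' x) = H ` elts V x"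
      using x(2) by (simp_all add: H'_def)
  qed
  have H'atom: "H' a = H a" "H a \<in> elts V ?A" if "a \<in> elts V ?A" for a
    using that atom_not_set[OF that] acts_atom_iff[OF assms, of a] AT by (auto simp: H'_def)
  have H'H: "H' u = H u" if u: "u \<in> elts V T" for u
  proof (cases "is_set V u")
    case True
    have "u \<in> elts V T'" using u T'(2) by simp
    from H'set[OF this True] st[OF u True] elts_univD[OF HT[OF u]] show ?thesis by (intro elts_eqI) auto
  next
    case False
    then show ?thesis by (simp add: H'_def)
  qed
  have H'T: "H' x \<in> elts V T'" if x: "x \<in> elts V T'" for x
  proof (cases "is_set V x")
    case True
    then show ?thesis using H'set[OF x True] HT T'set[OF x] unfolding T'(2) by auto
  next
    case False
    then show ?thesis using H'atom[OF T'atom[OF x False]] AT T'(2) by auto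
  qed
  have inj': "inj_on H' (elts V T')"
  proof (rule inj_onI)
    fix x y assume x: "x \<in> elts V T'" and y: "y \<in> elts V T'" and e: "H' x = H' y"
    have "is_set V x \<longleftrightarrow> is_set V y"
      using H'set(2)[OF x] H'set(2)[OF y] H'atom[OF T'atom[OF x]] H'atom[OF T'atom[OF y]] atom_not_set e by metis
    then consider "is_set V x" "is_set V y" | "\<not> is_set V x" "\<not> is_set V y" by blast
    then show "x = y"
    proof cases
      case 1
      then have "H ` elts V x = H ` elts V y" using H'set(3)[OF x] H'set(3)[OF y] e by simp
      then have "elts V x = elts V y" using inj T'set[OF x] T'set[OF y] by (simp add: inj_on_image_eq_iff)
      then show ?thesis using 1 elts_univD[OF x] elts_univD[OF y] by (intro elts_eqI)
    next
      case 2
      then have "x \<in> elts V T" "y \<in> elts V T" using T'atom x y AT by auto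
      then show ?thesis using e H'H inj by (auto dest: inj_onD)
    qed
  qed
  have "elts V T' \<subseteq> H' ` elts V T'"
  proof
    fix y assume y: "y \<in> elts V T'"
    show "y \<in> H' ` elts V T'"
    proof (cases "is_set V y")
      case True
      have l: "set [y, h] \<subseteq> univ V" using h(1) elts_univD[OF y] by simp
      have d: "definable 1 [y, h] (\<lambda>e. \<exists>v\<in>univ V. v \<epsilon>\<^bsub>V\<^esub> y \<and> maps_to V h (e 0) v)"
        by (intro definable_intros) simp_all
      \<comment> \<open>The preimage of \<open>y\<close> under \<open>H\<close>, expressed through
        \<open>h\<close>; its image is all of \<open>y\<close> because \<open>H\<close> is onto
        \<open>T\<close>.\<close>
      obtain x where x: "x \<in> univ V" "is_set V x"
        "elts V x = {u \<in> elts V T. \<exists>v\<in>univ V. v \<epsilon>\<^bsub>V\<^esub> y \<and> maps_to V h u v}"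
        using separation_definable[where Q = "\<lambda>u. \<exists>v\<in>univ V. v \<epsilon>\<^bsub>V\<^esub> y \<and> maps_to V h u v", OF T(1) l d] .
      have xe: "elts V x = {u \<in> elts V T. H u \<in> elts V y}"
        using h(3)[OF elts_univD] elts_univD[OF HT] unfolding x(3) by (auto simp: elts_def)
      have xT: "x \<in> elts V T'" using x xe unfolding T'(2) by auto
      have "H ` elts V x = elts V y"
      proof (intro equalityI subsetI)
        fix v assume v: "v \<in> elts V y"
        then have "v \<in> H ` elts V T" using T'set[OF y] sur by auto
        then obtain u where "u \<in> elts V T" "v = H u" by blast
        then show "v \<in> H ` elts V x" using v unfolding xe by blast
      qed (auto simp: xe)
      then have "H' x = y" using H'set[OF xT x(2)] elts_univD[OF y] True by (intro elts_eqI) auto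
      then show ?thesis using xT by blast
    next
      case False
      then have "y \<in> elts V T" using T'atom y AT by blast
      then obtain x where "x \<in> elts V T" "y = H x" using sur by blast
      then show ?thesis using H'H[of x] T'(2) by (intro image_eqI[of _ _ x]) auto
    qed
  qed
  then have bij': "bij_betw H' (elts V T') (elts V T')" using inj' H'T by (auto simp: bij_betw_def)

  \<comment> \<open>\<open>H'\<close> lives in the metatheory and cannot occur in a formula.
    \<open>R\<close> states the recursion equations through \<open>\<pi>\<close> and the old
    \<open>h\<close>, so that the function \<open>h'\<close> can be obtained in
    \<open>V\<close>.\<close>
  define R where "R x y \<longleftrightarrow> (x \<epsilon>\<^bsub>V\<^esub> atoms V \<and> maps_to V \<pi> x y) \<or> (is_set V x \<and> is_set V y \<and>
      (\<forall>v\<in>univ V. v \<epsilon>\<^bsub>V\<^esub> y \<longleftrightarrow> (\<exists>u\<in>univ V. u \<epsilon>\<^bsub>V\<^esub> x \<and> maps_to V h u v)))" for x y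
  have R: "R x y \<longleftrightarrow> y = H' x" if x: "x \<in> elts V T'" and y: "y \<in> elts V T'" for x y
  proof (cases "is_set V x")
    case True
    have "(\<exists>u\<in>univ V. u \<epsilon>\<^bsub>V\<^esub> x \<and> maps_to V h u v) \<longleftrightarrow> v \<in> H ` elts V x" if v: "v \<in> univ V" for v
      using h(3)[OF _ v] T'set[OF x] by (auto simp: elts_def)
    then have "(\<forall>v\<in>univ V. v \<epsilon>\<^bsub>V\<^esub> y \<longleftrightarrow> (\<exists>u\<in>univ V. u \<epsilon>\<^bsub>V\<^esub> x \<and> maps_to V h u v)) \<longleftrightarrow>
        (\<forall>v\<in>univ V. v \<in> elts V y \<longleftrightarrow> v \<in> elts V (H' x))"
      using H'set(3)[OF x True] by (simp add: mem_elts_iff)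
    also have "\<dots> \<longleftrightarrow> elts V y = elts V (H' x)" using elts_subset_univ[of V] by blast
    finally show ?thesis
      using True H'set[OF x True] elts_univD[OF y] elts_eqI[of y "H' x"] by (auto simp: R_def is_set_def)
  next
    case False
    then have a: "x \<in> elts V ?A" using T'atom x by blast
    have m: "maps_to V \<pi> x (H' x)" using at[OF a] H'atom[OF a] by simp
    have "maps_to V \<pi> x y \<longleftrightarrow> y = H' x"
      using m function_unique[OF fn _ m elts_univD[OF x] elts_univD[OF y] elts_univD[OF H'T[OF x]]] by blast
    then show ?thesis using a False by (simp add: R_def elts_def)
  qed
  have l: "set [T', \<pi>, h] \<subseteq> univ V" "T' \<in> set [T', \<pi>, h]" using T'u p h by auto
  have d: "definable (Suc (Suc 1)) [T', \<pi>, h] (\<lambda>e. R (e (Suc 0)) (e 0))"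
    unfolding R_def by (intro definable_intros) simp_all
  have tot: "\<exists>!b. b \<in> elts V T' \<and> R a b" if "a \<in> elts V T'" for a
    using R[OF that] H'T[OF that] by blast
  have onto: "\<exists>!a. a \<in> elts V T' \<and> R a b" if b: "b \<in> elts V T'" for b
  proof -
    obtain a where a: "a \<in> elts V T'" "b = H' a" using bij' b by (auto simp: bij_betw_def)
    then show ?thesis using R[OF _ b] inj' by (intro ex1I[of _ a]) (auto dest: inj_onD)
  qed
  obtain h' where h': "h' \<in> univ V" "is_bijection V h' T' T'"
    "\<And>a b. a \<in> univ V \<Longrightarrow> b \<in> univ V \<Longrightarrow> maps_to V h' a b \<longleftrightarrow> a \<in> elts V T' \<and> b \<in> elts V T' \<and> R a b"
    by (rule ex_bijection[where R = R, OF T'u(1,1,3,3) l l(2) d tot onto]) blast+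
  have "maps_to V h' a b \<longleftrightarrow> a \<in> elts V T' \<and> b = H' a" if "a \<in> univ V" "b \<in> univ V" for a b
    using h'(3)[OF that] R[of a b] H'T[of a] by blast
  moreover have "elts V (H' x) = H' ` elts V x" if "x \<in> elts V T'" "is_set V x" for x
    using H'set(3)[OF that] H'H T'set[OF that(1)] by (auto simp: image_iff subset_iff)
  moreover have "maps_to V \<pi> a (H' a)" if "a \<in> elts V ?A" for a using at[OF that] H'atom[OF that] by simp
  moreover have "elts V ?A \<subseteq> elts V T'" using AT T'(2) by auto
  ultimately have "acts \<pi> T' H'"
    unfolding acts_def
    using bexI[OF _ h'(1), of "\<lambda>h. is_function V h T' T' \<and>
        (\<forall>a\<in>univ V. \<forall>b\<in>univ V. maps_to V h a b \<longleftrightarrow> a \<in> elts V T' \<and> b = H' a)"]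
      bijection_is_function[OF h'(2)] bij' T'u H'set(2) by simp
  then show thesis using that T'(2) by blast
qed

lemma acts_level:
  assumes "\<pi> \<in> atom_perms V"
  obtains T H where "acts \<pi> T H" "elts V T = level (elts V (atoms V)) n"
proof -
  have "\<exists>T H. acts \<pi> T H \<and> elts V T = level (elts V (atoms V)) n"
  proof (induction n)
    case 0
    then show ?case using acts_atoms[OF assms] by (metis level.simps(1))
  next
    case (Suc n)
    then obtain T H where T: "acts \<pi> T H" "elts V T = level (elts V (atoms V)) n" by blast
    obtain T' H' where "acts \<pi> T' H'"
      "elts V T' = elts V T \<union> {x \<in> univ V. is_set V x \<and> elts V x \<subseteq> elts V T}"
      using acts_Pow[OF assms T(1)] .
    then show ?case using T(2) by auto
  qed
  then show thesis using that by blast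
qed

text \<open>Reduces fixing a set to invariance of membership in it. Invariance gives that
  \<open>H\<close> maps \<open>X\<close> into \<open>X\<close>; as \<open>H\<close> permutes
  \<open>T\<close>, which includes \<open>X\<close>, every element of \<open>X\<close> is also
  attained from \<open>X\<close>.\<close>

lemma acts_fixed:
  assumes "acts \<pi> T H" "X \<in> elts V T" "is_set V X"
    and "\<And>x. x \<in> elts V T \<Longrightarrow> H x \<in> elts V X \<longleftrightarrow> x \<in> elts V X"
  shows "H X = X"
proof -
  have XT: "elts V X \<subseteq> elts V T" and bij: "H ` elts V T = elts V T"
    using assms(1,2) by (auto simp: acts_def is_transitive_iff bij_betw_def)
  have "elts V X \<subseteq> H ` elts V X"
  proof
    fix y assume y: "y \<in> elts V X"
    then obtain x where "x \<in> elts V T" "y = H x" using XT bij by blast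
    then show "y \<in> H ` elts V X" using assms(4) y by blast
  qed
  then have "H ` elts V X = elts V X" using assms(4) XT by blast
  moreover have "H X \<in> univ V" using bij assms(2) elts_univD[of "H X" V T] by blast
  ultimately show ?thesis
    using assms(1-3) elts_univD[OF assms(2)] by (intro elts_eqI) (auto simp: acts_def)
qed

lemma acts_opair:
  assumes "acts \<pi> T H" "is_opair V a b p" "p \<in> elts V T" "a \<in> univ V" "b \<in> univ V"
  shows "a \<in> elts V T" "b \<in> elts V T" "is_opair V (H a) (H b) (H p)"
proof -
  have T: "\<And>y. y \<in> elts V T \<Longrightarrow> elts V y \<subseteq> elts V T"
    and st: "\<And>x. x \<in> elts V T \<Longrightarrow> is_set V x \<Longrightarrow> elts V (H x) = H ` elts V x"
    and HT: "\<And>x. x \<in> elts V T \<Longrightarrow> H x \<in> elts V T"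
    using assms(1) by (auto simp: acts_def is_transitive_iff dest: bij_betwE)
  obtain u v where uv: "u \<in> univ V" "v \<in> univ V" "elts V u = {a}" "elts V v = {a, b}" "elts V p = {u, v}"
    using assms(2) is_opair_iff[OF assms(4,5)] by blast
  have uvT: "u \<in> elts V T" "v \<in> elts V T" using T[OF assms(3)] uv(5) by auto
  then show ab: "a \<in> elts V T" "b \<in> elts V T" using T[of v] uv(4) by auto
  have "is_set V u" "is_set V v" "is_set V p"
    using set_if_elts[of u a] set_if_elts[of v a] uv opair_set[OF assms(2,4,5) elts_univD[OF assms(3)]] by auto
  then have "elts V (H u) = {H a}" "elts V (H v) = {H a, H b}" "elts V (H p) = {H u, H v}"
    using st uvT assms(3) uv by auto
  then show "is_opair V (H a) (H b) (H p)"
    using elts_univD[OF HT[OF uvT(1)]] elts_univD[OF HT[OF uvT(2)]]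
      is_opair_iff[OF elts_univD[OF HT[OF ab(1)]] elts_univD[OF HT[OF ab(2)]]] by blast
qed

text \<open>Serves to carry finiteness from \<open>H y\<close> back to \<open>y\<close>:
  \<open>finite_image\<close> asks for a single-valued relation, and this one has that
  property.\<close>

lemma ex_inverse:
  assumes "\<pi> \<in> atom_perms V"
  obtains \<rho> where "\<rho> \<in> univ V"
    "\<And>a b. a \<in> elts V (atoms V) \<Longrightarrow> b \<in> elts V (atoms V) \<Longrightarrow> maps_to V \<rho> a b \<longleftrightarrow> maps_to V \<pi> b a"
proof -
  have p: "\<pi> \<in> univ V" using assms by (simp add: atom_perms_def)
  let ?l = "[atoms V, \<pi>]"
  have l: "set ?l \<subseteq> univ V" "atoms V \<in> set ?l" using p atoms_in_univ by auto
  have d: "definable (Suc (Suc 1)) ?l (\<lambda>e. maps_to V \<pi> (e 0) (e (Suc 0)))" by (intro definable_intros) simp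
  obtain r where r: "r \<in> univ V"
    "\<And>a b. a \<in> univ V \<Longrightarrow> b \<in> univ V \<Longrightarrow>
      maps_to V r a b \<longleftrightarrow> a \<in> elts V (atoms V) \<and> b \<in> elts V (atoms V) \<and> maps_to V \<pi> b a"
    by (rule ex_relation[where R = "\<lambda>a b. maps_to V \<pi> b a", OF atoms_in_univ atoms_in_univ atoms_set atoms_set l l(2) d]) blast
  then show thesis using that[OF r(1)] r(2)[OF elts_univD elts_univD] by blast
qed

text \<open>On a set of atoms \<open>H\<close> is given by \<open>\<pi>\<close>, an element of
  \<open>V\<close>, so \<open>finite_image\<close> applies along \<open>\<pi>\<close> in one
  direction and along its inverse in the other.\<close>

lemma acts_finite_iff:
  assumes "\<pi> \<in> atom_perms V" "acts \<pi> T H" "y \<in> elts V T" "is_set V y" "elts V y \<subseteq> elts V (atoms V)"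
  shows "is_finite V (H y) \<longleftrightarrow> is_finite V y"
proof -
  let ?A = "atoms V"
  have p: "\<pi> \<in> univ V" "is_bijection V \<pi> ?A ?A" using assms(1) by (simp_all add: atom_perms_def)
  have fn: "is_function V \<pi> ?A ?A" using p(2) by (rule bijection_is_function)
  have st: "is_set V (H y)" "elts V (H y) = H ` elts V y" and HT: "H y \<in> elts V T"
    and at: "\<And>a. a \<in> elts V ?A \<Longrightarrow> maps_to V \<pi> a (H a)"
    using assms(2-4) by (auto simp: acts_def dest: bij_betwE)
  have yT: "elts V y \<subseteq> elts V T" using assms(2,3) by (auto simp: acts_def is_transitive_iff)
  have HA: "elts V (H y) \<subseteq> elts V ?A" using acts_atom_iff[OF assms(1,2)] assms(5) yT unfolding st(2) by blast
  obtain \<rho> where r: "\<rho> \<in> univ V"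
    "\<And>a b. a \<in> elts V ?A \<Longrightarrow> b \<in> elts V ?A \<Longrightarrow> maps_to V \<rho> a b \<longleftrightarrow> maps_to V \<pi> b a"
    using ex_inverse[OF assms(1)] by metis
  have u: "y \<in> univ V" "H y \<in> univ V" using assms(3) HT by (auto dest: elts_univD)
  show ?thesis
  proof
    assume "is_finite V y"
    then show "is_finite V (H y)"
    proof (rule finite_image[OF u(1) _ p(1) u(2) st(1)])
      fix v assume "v \<in> elts V (H y)"
      then show "\<exists>u\<in>elts V y. maps_to V \<pi> u v" using at assms(5) st(2) by auto
    next
      fix w v v' assume "w \<in> elts V y" "v \<in> elts V (H y)" "v' \<in> elts V (H y)" "maps_to V \<pi> w v" "maps_to V \<pi> w v'"
      then show "v = v'" by (intro function_unique[OF fn]) (auto intro: elts_univD)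
    qed
  next
    assume "is_finite V (H y)"
    then show "is_finite V y"
    proof (rule finite_image[OF u(2) _ r(1) u(1) assms(4)])
      fix v assume v: "v \<in> elts V y"
      then have "H v \<in> elts V (H y)" using st(2) by blast
      moreover from this v have "maps_to V \<rho> (H v) v" using r(2)[of "H v" v] at[of v] assms(5) HA by blast
      ultimately show "\<exists>u\<in>elts V (H y). maps_to V \<rho> u v" by blast
    next
      fix w v v' assume *: "w \<in> elts V (H y)" "v \<in> elts V y" "v' \<in> elts V y" "maps_to V \<rho> w v" "maps_to V \<rho> w v'"
      then have "maps_to V \<pi> v w" "maps_to V \<pi> v' w" using r(2) assms(5) HA by auto
      then show "v = v'" using * by (intro bijection_inject[OF p(2)]) (auto intro: elts_univD)
    qed
  qed
qed

section \<open>The colouring by singletons\<close>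

text \<open>The empty set is a support of \<open>x\<close>, since every permutation fixes
  \<open>x\<close> by \<open>acts_fixed\<close>. The elements of \<open>x\<close> may need nonempty
  supports, which is why their membership in the model is a separate premise.\<close>

lemma univ_N_if_fixed:
  assumes "is_set V x" "x \<in> level (elts V (atoms V)) n" "elts V x \<subseteq> univ N"
    and fixed: "\<And>\<pi> T H y. \<pi> \<in> atom_perms V \<Longrightarrow> acts \<pi> T H \<Longrightarrow> elts V T = level (elts V (atoms V)) n \<Longrightarrow>
      y \<in> elts V T \<Longrightarrow> H y \<in> elts V x \<longleftrightarrow> y \<in> elts V x"
  shows "x \<in> univ N"
proof -
  have A: "is_subset V (atoms V) (atoms V)" using atoms_set by (simp add: is_subset_iff)
  obtain t where t: "supported (atoms V) t" "elts V t = level (elts V (atoms V)) n"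
    using supported_level[OF supported_atoms[OF atoms_in_univ A]] .
  have tu: "t \<in> univ V" "is_transitive V t" "x \<in> elts V t" using t assms(2) by (simp_all add: supported_def)
  obtain E where E: "E \<in> univ V" "is_set V E" "elts V E = {}" using ex_empty .
  have "perm_image V \<pi> x x" if \<pi>: "\<pi> \<in> atom_perms V" for \<pi>
  proof -
    obtain T H where T: "acts \<pi> T H" "elts V T = level (elts V (atoms V)) n"
      using acts_level[OF \<pi>] .
    have xT: "x \<in> elts V T" using T(2) assms(2) by simp
    have "H x = x" using acts_fixed[OF T(1) xT assms(1) fixed[OF \<pi> T]] .
    then show ?thesis using acts_perm_image[OF T(1) xT] by simp
  qed
  then have "pointwise_stabilizer V E \<subseteq> stabilizer V x"
    by (auto simp: pointwise_stabilizer_def stabilizer_def)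
  moreover have "is_subset V E (atoms V)" using E atoms_set by (simp add: is_subset_iff)
  ultimately have "is_symmetric V x" using E(1) finite_empty[OF E] unfolding is_symmetric_def by blast
  then show ?thesis using univ_N_intro[OF elts_univD[OF tu(3)] assms(3) _ tu] by simp
qed

lemma finite_pair:
  assumes "a \<in> univ V" "b \<in> univ V" "x \<in> univ V" "elts V x = {a, b}"
  shows "is_finite V x"
proof -
  obtain z where z: "z \<in> univ V" "is_set V z" "elts V z = {}" using ex_empty .
  obtain u where u: "u \<in> univ V" "is_set V u" "elts V u = {a, a}" using ex_pair[OF assms(1,1)] .
  have "is_finite V u" using finite_insert[OF z(1) finite_empty[OF z] assms(1) u(1,2)] u(3) z(3) by simp
  then show ?thesis
    using finite_insert[OF u(1) _ assms(2,3) set_if_elts[OF assms(3)]] assms(4) u(3) by auto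
qed

text \<open>Whatever is built in finitely many power-set steps from the elements of \<open>E\<close>
  has support \<open>E\<close>. Concrete witnesses such as atoms, finite sets of atoms and finite
  families of these enter the model in this way.\<close>

lemma finite_subset_in_N:
  assumes "E \<in> univ V" "is_subset V E (atoms V)" "is_finite V E"
  shows "level (elts V E) n \<subseteq> univ N"
    and "x \<in> level (elts V E) n \<Longrightarrow> is_finite V x \<Longrightarrow> is_finite N x"
proof -
  obtain T where T: "supported E T" "elts V T = level (elts V E) n"
    using supported_level[OF supported_atoms[OF assms(1,2)]] .
  show "level (elts V E) n \<subseteq> univ N" using supported_subset_N[OF T(1) assms] T(2) by simp
  show "x \<in> level (elts V E) n \<Longrightarrow> is_finite V x \<Longrightarrow> is_finite N x"
    using finite_N_if_finite[OF T(1) assms] T(2) by simp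
qed

lemma atoms_in_N: "atoms V \<in> univ N"
proof (rule univ_N_if_fixed)
  show "is_set V (atoms V)" by (rule atoms_set)
  show "atoms V \<in> level (elts V (atoms V)) 1"
    using atoms_in_univ atoms_set by simp
  show "elts V (atoms V) \<subseteq> univ N"
  proof
    fix a assume a: "a \<in> elts V (atoms V)"
    have au: "a \<in> univ V" using a by (rule elts_univD)
    \<comment> \<open>An atom is supported by its own singleton and lies on level 0 above
      it.\<close>
    obtain E where E: "E \<in> univ V" "is_set V E" "elts V E = {a, a}" using ex_pair[OF au au] .
    have "is_subset V E (atoms V)" using E atoms_set a by (simp add: is_subset_iff)
    then have "level (elts V E) 0 \<subseteq> univ N"
      using finite_subset_in_N(1)[OF E(1) _ finite_pair[OF au au E(1,3)]] by blast
    then show "a \<in> univ N" using E by simp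
  qed
next
  fix \<pi> T H y assume "\<pi> \<in> atom_perms V" "acts \<pi> T H" "y \<in> elts V T"
  then show "H y \<in> elts V (atoms V) \<longleftrightarrow> y \<in> elts V (atoms V)" by (rule acts_atom_iff)
qed

lemma acts_finite_atoms_iff:
  assumes "\<pi> \<in> atom_perms V" "acts \<pi> T H" "y \<in> elts V T"
  shows "is_set V (H y) \<and> elts V (H y) \<subseteq> elts V (atoms V) \<and> is_finite V (H y) \<longleftrightarrow>
    is_set V y \<and> elts V y \<subseteq> elts V (atoms V) \<and> is_finite V y"
proof -
  have T: "H y \<in> elts V T" "is_set V y \<Longrightarrow> is_set V (H y) \<and> elts V (H y) = H ` elts V y"
    "elts V y \<subseteq> elts V T"
    using assms(2,3) by (auto simp: acts_def is_transitive_iff dest: bij_betwE)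
  have "is_set V (H y) \<longleftrightarrow> is_set V y"
    using acts_atom_iff[OF assms] is_set_elts_iff[OF elts_univD[OF T(1)]]
      is_set_elts_iff[OF elts_univD[OF assms(3)]] by simp
  moreover have "elts V (H y) \<subseteq> elts V (atoms V) \<longleftrightarrow> elts V y \<subseteq> elts V (atoms V)" if "is_set V y"
  proof -
    have "H x \<in> elts V (atoms V) \<longleftrightarrow> x \<in> elts V (atoms V)" if "x \<in> elts V y" for x
      using acts_atom_iff[OF assms(1,2)] that T(3) by blast
    then show ?thesis using T(2)[OF that] by auto
  qed
  ultimately show ?thesis using acts_finite_iff[OF assms] by blast
qed

text \<open>The finite sets of atoms are the same in \<open>V\<close> and in the model, so
  \<open>P\<close> can be formed in \<open>V\<close>; its defining condition is invariant under all
  permutations.\<close>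

lemma ex_fin_subsets:
  obtains P where "P \<in> univ N" "is_set V P" "is_fin_subsets N (atoms V) P"
    "elts V P = {y \<in> univ V. is_set V y \<and> elts V y \<subseteq> elts V (atoms V) \<and> is_finite V y}"
proof -
  obtain p where p: "p \<in> univ V" "elts V p = {y \<in> univ V. is_set V y \<and> elts V y \<subseteq> elts V (atoms V)}"
    using ex_Pow[OF atoms_in_univ atoms_set] .
  have l: "set [] \<subseteq> univ V" by simp
  have d: "definable 1 [] (\<lambda>e. is_finite V (e 0))" by (intro definable_intros)
  obtain P where P: "P \<in> univ V" "is_set V P" "elts V P = {y \<in> elts V p. is_finite V y}"
    using separation_definable[where Q = "is_finite V", OF p(1) l d] .
  have eP: "elts V P = {y \<in> univ V. is_set V y \<and> elts V y \<subseteq> elts V (atoms V) \<and> is_finite V y}"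
    using P(3) p(2) by auto
  have fin: "y \<in> univ N \<and> is_finite N y" if y: "y \<in> elts V P" for y
  proof -
    have y': "y \<in> univ V" "is_set V y" "is_subset V y (atoms V)" "is_finite V y"
      using y atoms_set unfolding eP by (simp_all add: is_subset_iff)
    \<comment> \<open>A finite set of atoms is its own support.\<close>
    have "y \<in> level (elts V y) 1" using y' by simp
    then show ?thesis using finite_subset_in_N[OF y'(1,3,4), where n = 1] y'(4) by blast
  qed
  have "P \<in> univ N"
  proof (rule univ_N_if_fixed[OF P(2)])
    have "elts V P \<subseteq> level (elts V (atoms V)) 1" unfolding eP by auto
    then show "P \<in> level (elts V (atoms V)) (Suc 1)" by (rule level_SucI[OF P(1,2)])
    show "elts V P \<subseteq> univ N" using fin by blast
    fix \<pi> T H y assume h: "\<pi> \<in> atom_perms V" "acts \<pi> T H" "y \<in> elts V T"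
    then have "H y \<in> elts V T" by (auto simp: acts_def dest: bij_betwE)
    then show "H y \<in> elts V P \<longleftrightarrow> y \<in> elts V P"
      using acts_finite_atoms_iff[OF h] elts_univD[OF h(3)] unfolding eP by (auto dest: elts_univD)
  qed
  moreover have "is_fin_subsets N (atoms V) P"
    unfolding is_fin_subsets_def
  proof (intro conjI ballI)
    fix y assume y: "y \<in> univ N"
    have "y \<in> elts V P \<longleftrightarrow> is_subset N y (atoms V) \<and> is_finite N y"
      using y fin finite_if_finite_N[OF y] univ_N_subset[OF y] atoms_set atoms_in_N
      unfolding eP by (auto simp: is_subset_iff)
    then show "y \<epsilon>\<^bsub>N\<^esub> P \<longleftrightarrow> is_subset N y (atoms V) \<and> is_finite N y"
      using univ_N_subset[OF y] by (simp add: mem_elts_iff)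
  qed (use P in simp)
  ultimately show thesis using that P(2) eP by blast
qed

lemma acts_singleton_iff:
  assumes "acts \<pi> T H" "y \<in> elts V T" "is_set V y"
  shows "(\<exists>a. elts V (H y) = {a}) \<longleftrightarrow> (\<exists>a. elts V y = {a})"
proof -
  have yT: "elts V y \<subseteq> elts V T" and e: "elts V (H y) = H ` elts V y" and inj: "inj_on H (elts V T)"
    using assms by (auto simp: acts_def is_transitive_iff bij_betw_def)
  have "inj_on H (elts V y)" using inj yT by (rule inj_on_subset)
  \<comment> \<open>\<open>card\<close> is that of the metatheory and gives 0 for infinite sets;
    this is harmless, as only the value 1 matters.\<close>
  then have "card (elts V (H y)) = card (elts V y)" unfolding e by (rule card_image)
  then show ?thesis by (metis card_1_singletonE is_singletonI is_singleton_altdef)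
qed

lemma acts_pure_fixed:
  assumes "acts \<pi> T H" "x \<in> elts V T" "is_set V x" "\<And>y. y \<in> elts V x \<Longrightarrow> H y = y"
  shows "H x = x"
proof -
  have "is_set V (H x)" "elts V (H x) = elts V x" "H x \<in> elts V T"
    using assms by (auto simp: acts_def dest: bij_betwE)
  then show ?thesis using assms(2,3) by (intro elts_eqI) (auto dest: elts_univD)
qed

text \<open>A pair \<open>(y, i)\<close> belongs to \<open>c\<close> when \<open>i = one\<close> is
  equivalent to \<open>y\<close> being a singleton; as \<open>i\<close> is \<open>zero\<close> or
  \<open>one\<close>, this determines \<open>i\<close>. The condition is invariant, so
  \<open>c\<close> has empty support, while each single pair in \<open>c\<close> is supported by its
  first component \<open>y\<close>.\<close>

lemma ex_colouring:
  assumes P: "P \<in> univ N" "is_set V P"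
    "elts V P = {y \<in> univ V. is_set V y \<and> elts V y \<subseteq> elts V (atoms V) \<and> is_finite V y}"
  obtains one two c where "two \<in> univ N" "is_two N two" "c \<in> univ N" "is_function N c P two"
    "\<And>y i. y \<in> univ V \<Longrightarrow> i \<in> univ V \<Longrightarrow> maps_to V c y i \<Longrightarrow> i = one \<longleftrightarrow> (\<exists>a. elts V y = {a})"
proof -
  let ?A = "elts V (atoms V)"
  obtain zero where zero: "zero \<in> univ V" "is_set V zero" "elts V zero = {}" using ex_empty .
  obtain one where one: "one \<in> univ V" "is_set V one" "elts V one = {zero, zero}" using ex_pair[OF zero(1,1)] .
  obtain two where two: "two \<in> univ V" "is_set V two" "elts V two = {zero, one}" using ex_pair[OF zero(1) one(1)] .
  have lz: "zero \<in> level X 1" for X using zero by simp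
  have lo: "one \<in> level X (Suc 1)" for X using lz[of X] one by (intro level_SucI) auto
  have lz': "zero \<in> level X (Suc 1)" for X using lz[of X] level_mono[of 1 "Suc 1" X] by auto
  have lt: "two \<in> level X (Suc (Suc 1))" for X using lo[of X] lz'[of X] two by (intro level_SucI) auto
  \<comment> \<open>The empty set now also acts as a finite support: \<open>zero\<close>,
    \<open>one\<close> and \<open>two\<close> occur on levels above an empty ground level.\<close>
  have zs: "is_subset V zero (atoms V)" using zero atoms_set by (simp add: is_subset_iff)
  note pure = finite_subset_in_N(1)[OF zero(1) zs finite_empty[OF zero], THEN subsetD]
  have N012: "zero \<in> univ N" "one \<in> univ N" "two \<in> univ N" using pure[OF lz] pure[OF lo] pure[OF lt] .
  have "is_two N two"
    unfolding is_two_def using N012 zero one two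
    by (intro bexI[of _ zero] bexI[of _ one]) (simp_all add: is_empty_iff is_upair_iff)
  \<comment> \<open>Being a singleton is spelled out through membership so that the closure rules
    produce a formula for it.\<close>
  define R where "R y i \<longleftrightarrow> (i = one \<longleftrightarrow> (\<exists>a\<in>univ V. \<forall>z\<in>univ V. z \<epsilon>\<^bsub>V\<^esub> y \<longleftrightarrow> z = a))" for y i
  have R: "R y i \<longleftrightarrow> (i = one \<longleftrightarrow> (\<exists>a. elts V y = {a}))" for y i
  proof -
    have "(\<exists>a\<in>univ V. \<forall>z\<in>univ V. z \<epsilon>\<^bsub>V\<^esub> y \<longleftrightarrow> z = a) \<longleftrightarrow> (\<exists>a. elts V y = {a})"
      by (auto simp: elts_def)
    then show ?thesis by (simp add: R_def)
  qed
  have neq: "zero \<noteq> one" using zero one by auto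
  have l: "set [P, two, one] \<subseteq> univ V" "P \<in> set [P, two, one]" "two \<in> set [P, two, one]"
    using univ_N_subset[OF P(1)] one two by auto
  have d: "definable (Suc (Suc 1)) [P, two, one] (\<lambda>e. R (e (Suc 0)) (e 0))"
    unfolding R_def by (intro definable_intros) simp_all
  obtain c where c: "c \<in> univ V" "is_set V c"
    "elts V c = {p \<in> univ V. \<exists>y\<in>elts V P. \<exists>i\<in>elts V two. is_opair V y i p \<and> R y i}"
    "\<And>y i. y \<in> univ V \<Longrightarrow> i \<in> univ V \<Longrightarrow> maps_to V c y i \<longleftrightarrow> y \<in> elts V P \<and> i \<in> elts V two \<and> R y i"
    by (rule ex_relation[where R = R, OF univ_N_subset[OF P(1)] two(1) P(2) two(2) l d]) blast
  have "\<exists>!i. i \<in> univ V \<and> maps_to V c y i" if y: "y \<in> elts V P" for y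
  proof -
    have "(i \<in> univ V \<and> maps_to V c y i) \<longleftrightarrow> i = (if \<exists>a. elts V y = {a} then one else zero)" for i
      using c(4)[OF elts_univD[OF y], of i] y two(3) zero(1) one(1) neq by (auto simp: R)
    then show ?thesis by simp
  qed
  then have fn: "is_function V c P two" unfolding is_function_iff using c(2,3) by auto
  \<comment> \<open>\<open>y\<close> is on level 1 and \<open>i\<close> on level 2, so the pair is
    on level 4; hence \<open>c\<close> is on level 5.\<close>
  have pair_level: "p \<in> level X (Suc (Suc (Suc 1)))"
    if h: "is_opair V y i p" "y \<in> level X 1" "i \<in> elts V two" "y \<in> univ V" "p \<in> univ V" for X y i p
  proof -
    have "y \<in> level X (Suc 1)" using h(2) level_mono[of 1 "Suc 1" X] by auto
    moreover have "i \<in> level X (Suc 1)" using h(3) lz'[of X] lo[of X] unfolding two(3) by auto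
    ultimately show ?thesis using opair_level[OF h(1) _ _ h(4) elts_univD[OF h(3)] h(5)] by blast
  qed
  have yl: "y \<in> level ?A 1" if "y \<in> elts V P" for y using that unfolding P(3) by simp
  have "c \<in> univ N"
  proof (rule univ_N_if_fixed[OF c(2)])
    have "elts V c \<subseteq> level ?A (Suc (Suc (Suc 1)))"
    proof
      fix p assume p: "p \<in> elts V c"
      then obtain y i where "y \<in> elts V P" "i \<in> elts V two" "is_opair V y i p" unfolding c(3) by blast
      then show "p \<in> level ?A (Suc (Suc (Suc 1)))"
        using pair_level[of y i p ?A] yl elts_univD[OF p] elts_univD[of y V P] by (simp del: level.simps)
    qed
    then show "c \<in> level ?A (Suc (Suc (Suc (Suc 1))))" by (rule level_SucI[OF c(1,2)])
    show "elts V c \<subseteq> univ N"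
    proof
      fix p assume p: "p \<in> elts V c"
      then obtain y i where yi: "y \<in> elts V P" "i \<in> elts V two" "is_opair V y i p" unfolding c(3) by blast
      have y: "y \<in> univ V" "is_set V y" "is_subset V y (atoms V)" "is_finite V y"
        using yi(1) atoms_set unfolding P(3) by (simp_all add: is_subset_iff)
      have "y \<in> level (elts V y) 1" using y by simp
      then have "p \<in> level (elts V y) (Suc (Suc (Suc 1)))" using pair_level yi y(1) elts_univD[OF p] by blast
      then show "p \<in> univ N" using finite_subset_in_N(1)[OF y(1,3,4)] by blast
    qed
    fix \<pi> T H p assume \<pi>: "\<pi> \<in> atom_perms V" and H: "acts \<pi> T H" and p: "p \<in> elts V T"
      and T: "elts V T = level ?A (Suc (Suc (Suc (Suc 1))))"
    have bij: "bij_betw H (elts V T) (elts V T)" and TT: "\<And>y. y \<in> elts V T \<Longrightarrow> elts V y \<subseteq> elts V T"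
      using H by (auto simp: acts_def is_transitive_iff)
    have HT: "H x \<in> elts V T" if "x \<in> elts V T" for x using bij that by (auto dest: bij_betwE)
    have lT: "level ?A m \<subseteq> elts V T" if "m \<le> Suc (Suc (Suc (Suc 1)))" for m
      unfolding T using that by (rule level_mono)
    have zT: "zero \<in> elts V T" "one \<in> elts V T" using lz[of ?A] lo[of ?A] lT[of 1] lT[of "Suc 1"] by auto
    have Hz: "H zero = zero" using zero by (intro acts_pure_fixed[OF H zT(1)]) auto
    have Ho: "H one = one" using one Hz by (intro acts_pure_fixed[OF H zT(2)]) auto
    have Hi: "H i = i" if "i \<in> elts V two" for i using that Hz Ho unfolding two(3) by auto
    have PT: "P \<in> elts V T"
    proof -
      have "P \<in> level ?A (Suc 1)" using yl P(1,2) univ_N_subset by (intro level_SucI) auto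
      then show ?thesis using lT[of "Suc 1"] by auto
    qed
    have HP: "H y \<in> elts V P \<longleftrightarrow> y \<in> elts V P" if y: "y \<in> elts V T" for y
      using acts_finite_atoms_iff[OF \<pi> H y] elts_univD[OF HT[OF y]] elts_univD[OF y] unfolding P(3) by blast
    have HR: "R (H y) i \<longleftrightarrow> R y i" if "y \<in> elts V T" "y \<in> elts V P" for y i
      using acts_singleton_iff[OF H that(1)] that(2) unfolding R P(3) by simp
    show "H p \<in> elts V c \<longleftrightarrow> p \<in> elts V c"
    proof
      assume "p \<in> elts V c"
      then obtain y i where yi: "y \<in> elts V P" "i \<in> elts V two" "is_opair V y i p" "R y i" unfolding c(3) by blast
      note * = acts_opair[OF H yi(3) p elts_univD[OF yi(1)] elts_univD[OF yi(2)]]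
      have "H y \<in> elts V P" "is_opair V (H y) i (H p)" "R (H y) i"
        using HP[OF *(1)] HR[OF *(1) yi(1)] *(3) Hi yi by auto
      then show "H p \<in> elts V c" using yi(2) elts_univD[OF HT[OF p]] unfolding c(3) by blast
    next
      \<comment> \<open>\<open>acts_opair\<close> moves pairs forward only. So \<open>y'\<close> is
        pulled back along \<open>H\<close> to \<open>y\<close>, the pair \<open>q\<close> of
        \<open>y\<close> and \<open>i\<close> is formed, and injectivity of \<open>H\<close> gives
        \<open>q = p\<close>.\<close>
      assume "H p \<in> elts V c"
      then obtain y' i where yi: "y' \<in> elts V P" "i \<in> elts V two" "is_opair V y' i (H p)" "R y' i"
        unfolding c(3) by blast
      have "y' \<in> elts V T" using TT[OF PT] yi(1) by blast
      then obtain y where y: "y \<in> elts V T" "y' = H y" using bij by (auto simp: bij_betw_def)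
      have yP: "y \<in> elts V P" using HP[OF y(1)] y(2) yi(1) by simp
      have iu: "i \<in> univ V" using yi(2) by (rule elts_univD)
      obtain q where q: "q \<in> univ V" "is_opair V y i q" using ex_opair[OF elts_univD[OF y(1)] iu] .
      have qT: "q \<in> elts V T"
        using pair_level[OF q(2) yl[OF yP] yi(2) elts_univD[OF y(1)] q(1)] lT[of "Suc (Suc (Suc 1))"] by auto
      have "is_opair V y' i (H q)"
        using acts_opair(3)[OF H q(2) qT elts_univD[OF y(1)] iu] Hi[OF yi(2)] y(2) by simp
      then have "H q = H p"
        using opair_unique[OF _ yi(3) elts_univD[OF yi(1)] iu elts_univD[OF HT[OF qT]] elts_univD[OF HT[OF p]]] by blast
      then have "q = p" using bij qT p by (auto simp: bij_betw_def dest: inj_onD)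
      then show "p \<in> elts V c" using q yP yi(2,4) HR[OF y(1) yP] y(2) unfolding c(3) by blast
    qed
  qed
  moreover from this have "is_function N c P two" using fn is_function_N P(1) N012(3) by simp
  moreover have "i = one \<longleftrightarrow> (\<exists>a. elts V y = {a})" if "y \<in> univ V" "i \<in> univ V" "maps_to V c y i" for y i
    using c(4)[OF that(1,2)] that(3) R by simp
  ultimately show thesis using that[OF N012(3) \<open>is_two N two\<close>] by blast
qed

section \<open>Homogeneous families\<close>

text \<open>Here the recursion witness \<open>f\<close> on \<open>t\<close> is not constructed but
  handed over by the symmetry of \<open>Y\<close>. Its equations are read in three places only: at
  \<open>Y\<close>, at the element \<open>y\<close>, and at the atoms in \<open>y\<close>, where
  \<open>f\<close> has to agree with \<open>\<pi>\<close>.\<close>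

lemma perm_image_mem:
  assumes "\<pi> \<in> atom_perms V" "perm_image V \<pi> Y Y" "Y \<in> univ V" "y \<in> elts V Y" "is_set V y"
    and "elts V y \<subseteq> elts V (atoms V)"
  obtains y' where "y' \<in> elts V Y" "is_set V y'"
    "\<And>v. v \<in> elts V y' \<longleftrightarrow> v \<in> univ V \<and> (\<exists>u\<in>elts V y. maps_to V \<pi> u v)"
proof -
  have fn: "is_function V \<pi> (atoms V) (atoms V)"
    using assms(1) bijection_is_function[of V \<pi>] by (simp add: atom_perms_def)
  obtain t f where tf: "t \<in> univ V" "f \<in> univ V" "is_transitive V t" "Y \<in> elts V t"
      "extends_perm V \<pi> t f" "maps_to V f Y Y"
    using assms(2,3) by (auto simp: perm_image_def elts_def)
  have Ys: "is_set V Y" using set_if_elts[OF assms(3,4)] .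
  have fT: "\<exists>r\<in>univ V. is_function V f t r"
    and eq: "\<forall>x\<in>univ V. \<forall>y\<in>univ V. x \<epsilon>\<^bsub>V\<^esub> t \<and> maps_to V f x y \<longrightarrow>
        (if x \<epsilon>\<^bsub>V\<^esub> atoms V then maps_to V \<pi> x y
         else is_set V y \<and> (\<forall>v\<in>univ V. v \<epsilon>\<^bsub>V\<^esub> y \<longleftrightarrow> (\<exists>u\<in>univ V. u \<epsilon>\<^bsub>V\<^esub> x \<and> maps_to V f u v)))"
    using tf(5) by (auto simp: extends_perm_def)
  obtain r where f: "is_function V f t r" using fT by blast
  have sets: "is_set V z \<and> (\<forall>v. v \<in> elts V z \<longleftrightarrow> v \<in> univ V \<and> (\<exists>u\<in>elts V x. maps_to V f u v))"
    if x: "x \<in> elts V t" "is_set V x" and z: "z \<in> univ V" "maps_to V f x z" for x z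
  proof -
    have "is_set V z \<and> (\<forall>v\<in>univ V. v \<epsilon>\<^bsub>V\<^esub> z \<longleftrightarrow> (\<exists>u\<in>univ V. u \<epsilon>\<^bsub>V\<^esub> x \<and> maps_to V f u v))"
      using eq[rule_format, OF elts_univD[OF x(1)] z(1)] x z(2) by (auto simp: is_set_def elts_def)
    then show ?thesis by (auto simp: elts_def)
  qed
  have at: "maps_to V \<pi> a b" if "a \<in> elts V t" "a \<in> elts V (atoms V)" "b \<in> univ V" "maps_to V f a b" for a b
    using eq[rule_format, OF elts_univD[OF that(1)] that(3)] that by (auto simp: elts_def)
  have yt: "y \<in> elts V t" and yt': "elts V y \<subseteq> elts V t"
    using tf(3,4) assms(4) by (auto simp: is_transitive_iff)
  obtain y' where y': "y' \<in> elts V r" "maps_to V f y y'" using function_total[OF f yt] .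
  have y'u: "y' \<in> univ V" using y'(1) by (rule elts_univD)
  have "y' \<in> elts V Y" using sets[OF tf(4) Ys assms(3) tf(6)] y'(2) y'u assms(4) by blast
  moreover have "maps_to V f u v \<longleftrightarrow> maps_to V \<pi> u v" if u: "u \<in> elts V y" and v: "v \<in> univ V" for u v
  proof
    assume "maps_to V f u v"
    then show "maps_to V \<pi> u v" using at u v yt' assms(6) by blast
  next
    \<comment> \<open>The equation at an atom turns values of \<open>f\<close> into values of
      \<open>\<pi>\<close>. Conversely \<open>f\<close> has some value at \<open>u\<close>, and
      single-valuedness of \<open>\<pi>\<close> identifies it with \<open>v\<close>.\<close>
    assume m: "maps_to V \<pi> u v"
    have ut: "u \<in> elts V t" using u yt' by blast
    obtain w where w: "w \<in> elts V r" "maps_to V f u w" using function_total[OF f ut] .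
    have "maps_to V \<pi> u w" using at[OF ut _ elts_univD[OF w(1)] w(2)] u assms(6) by blast
    then have "w = v" using function_unique[OF fn _ m elts_univD[OF u] elts_univD[OF w(1)] v] by blast
    then show "maps_to V f u v" using w(2) by simp
  qed
  then have "v \<in> elts V y' \<longleftrightarrow> v \<in> univ V \<and> (\<exists>u\<in>elts V y. maps_to V \<pi> u v)" for v
    using sets[OF yt assms(5) y'u y'(2)] by auto
  ultimately show thesis using that sets[OF yt assms(5) y'u y'(2)] by blast
qed

lemma ex_transposition:
  assumes "a \<in> elts V (atoms V)" "b \<in> elts V (atoms V)"
  obtains \<pi> where "\<pi> \<in> atom_perms V"
    "\<And>u v. u \<in> univ V \<Longrightarrow> v \<in> univ V \<Longrightarrow> maps_to V \<pi> u v \<longleftrightarrow> u \<in> elts V (atoms V) \<and>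
       v = (if u = a then b else if u = b then a else u)"
proof -
  let ?A = "atoms V"
  let ?s = "\<lambda>u. if u = a then b else if u = b then a else u"
  \<comment> \<open>The conditional is written as a disjunction, to which the closure rules for
    definability apply.\<close>
  let ?R = "\<lambda>u v. u = a \<and> v = b \<or> u = b \<and> v = a \<or> (u \<noteq> a \<and> u \<noteq> b \<and> v = u)"
  have l: "set [?A, a, b] \<subseteq> univ V" "?A \<in> set [?A, a, b]"
    using assms[THEN elts_univD] atoms_in_univ by auto
  have d: "definable (Suc (Suc 1)) [?A, a, b] (\<lambda>e. ?R (e (Suc 0)) (e 0))"
    by (intro definable_intros) simp_all
  obtain \<pi> where p: "\<pi> \<in> univ V" "is_bijection V \<pi> ?A ?A"
    "\<And>u v. u \<in> univ V \<Longrightarrow> v \<in> univ V \<Longrightarrow> maps_to V \<pi> u v \<longleftrightarrow> u \<in> elts V ?A \<and> v \<in> elts V ?A \<and> ?R u v"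
  proof (rule ex_bijection[where R = ?R, OF atoms_in_univ atoms_in_univ atoms_set atoms_set l l(2) d])
    show "\<exists>!v. v \<in> elts V ?A \<and> ?R u v" if "u \<in> elts V ?A" for u
      using that assms by (intro ex1I[of _ "?s u"]) auto
    show "\<exists>!u. u \<in> elts V ?A \<and> ?R u v" if "v \<in> elts V ?A" for v
      using that assms by (intro ex1I[of _ "?s v"]) auto
  qed blast
  have "maps_to V \<pi> u v \<longleftrightarrow> u \<in> elts V ?A \<and> v = ?s u" if "u \<in> univ V" "v \<in> univ V" for u v
    using p(3)[OF that] assms by auto
  then show thesis using that[of \<pi>] p(1,2) by (simp add: atom_perms_def)
qed

text \<open>By disjointness each element of \<open>E\<close> lies in at most one member, so
  membership is a single-valued relation from \<open>E\<close> onto the nonempty members, and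
  \<open>finite_image\<close> applies. The empty set may be one further member; it is added back at
  the end.\<close>

lemma finite_disjoint_family:
  assumes "E \<in> univ V" "is_finite V E" "Y \<in> univ V" "is_set V Y"
    and "\<And>y. y \<in> elts V Y \<Longrightarrow> is_set V y \<and> elts V y \<subseteq> elts V E"
    and disj: "\<And>y y'. y \<in> elts V Y \<Longrightarrow> y' \<in> elts V Y \<Longrightarrow> y \<noteq> y' \<Longrightarrow> elts V y \<inter> elts V y' = {}"
  shows "is_finite V Y"
proof -
  have d: "definable 1 [] (\<lambda>e. \<exists>z\<in>univ V. z \<epsilon>\<^bsub>V\<^esub> e 0)" by (intro definable_intros)
  have l: "set [] \<subseteq> univ V" by simp
  obtain Y' where Y': "Y' \<in> univ V" "is_set V Y'" "elts V Y' = {y \<in> elts V Y. \<exists>z\<in>univ V. z \<epsilon>\<^bsub>V\<^esub> y}"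
    using separation_definable[where Q = "\<lambda>y. \<exists>z\<in>univ V. z \<epsilon>\<^bsub>V\<^esub> y", OF assms(3) l d] .
  have Y'e: "elts V Y' = {y \<in> elts V Y. elts V y \<noteq> {}}" unfolding Y'(3) by (auto simp: elts_def)
  have l: "set [E, Y'] \<subseteq> univ V" "E \<in> set [E, Y']" "Y' \<in> set [E, Y']" using assms(1) Y'(1) by auto
  have d: "definable (Suc (Suc 1)) [E, Y'] (\<lambda>e. e (Suc 0) \<epsilon>\<^bsub>V\<^esub> e 0)" by (intro definable_intros)
  obtain r where r: "r \<in> univ V"
    "\<And>u y. u \<in> univ V \<Longrightarrow> y \<in> univ V \<Longrightarrow> maps_to V r u y \<longleftrightarrow> u \<in> elts V E \<and> y \<in> elts V Y' \<and> u \<epsilon>\<^bsub>V\<^esub> y"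
    by (rule ex_relation[where R = "mem V", OF assms(1) Y'(1) finite_set[OF assms(2)] Y'(2) l d]) blast
  have r': "maps_to V r u y \<longleftrightarrow> u \<in> elts V y" if u: "u \<in> elts V E" and y: "y \<in> elts V Y'" for u y
    using r(2)[OF elts_univD[OF u] elts_univD[OF y]] u y elts_univD[OF u] by (simp add: mem_elts_iff)
  have fin: "is_finite V Y'"
  proof (rule finite_image[OF assms(1,2) r(1) Y'(1,2)])
    fix y assume y: "y \<in> elts V Y'"
    then obtain u where "u \<in> elts V y" unfolding Y'e by blast
    moreover from this have "u \<in> elts V E" using y assms(5) unfolding Y'e by blast
    ultimately show "\<exists>u\<in>elts V E. maps_to V r u y" using r' y by blast
  next
    fix u y y' assume *: "u \<in> elts V E" "y \<in> elts V Y'" "y' \<in> elts V Y'" "maps_to V r u y" "maps_to V r u y'"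
    then have "u \<in> elts V y \<inter> elts V y'" using r' by simp
    then show "y = y'" using disj[of y y'] *(2,3) unfolding Y'e by blast
  qed
  show ?thesis
  proof (cases "\<exists>z\<in>elts V Y. elts V z = {}")
    case True
    then obtain z where z: "z \<in> elts V Y" "elts V z = {}" by blast
    have "y = z" if y: "y \<in> elts V Y" "elts V y = {}" for y
      using assms(5)[OF z(1)] assms(5)[OF y(1)] y z elts_univD[OF y(1)] elts_univD[OF z(1)] by (intro elts_eqI) auto
    then have "elts V Y = insert z (elts V Y')" using z unfolding Y'e by blast
    then show ?thesis using finite_insert[OF Y'(1) fin elts_univD[OF z(1)] assms(3,4)] by blast
  next
    case False
    then have "Y = Y'" using assms(3,4) Y'(1,2) Y'e by (intro elts_eqI) auto
    then show ?thesis using fin by simp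
  qed
qed

text \<open>The two sets are the unions of the subfamilies \<open>{y}\<close> and
  \<open>{y, y'}\<close> of \<open>Y\<close>, where \<open>y'\<close> is the image of
  \<open>y\<close>. As \<open>in_FU\<close> is evaluated in the model, these subfamilies must be in
  the model and finite there.\<close>

lemma infinite_family_FU:
  assumes cinf: "is_countably_infinite V (atoms V)"
    and Y: "Y \<in> univ N" "is_infinite N Y"
    and sub: "\<And>y. y \<in> elts V Y \<Longrightarrow> is_set V y \<and> elts V y \<subseteq> elts V (atoms V) \<and> is_finite V y"
    and disj: "\<And>y y'. y \<in> elts V Y \<Longrightarrow> y' \<in> elts V Y \<Longrightarrow> y \<noteq> y' \<Longrightarrow> elts V y \<inter> elts V y' = {}"
  obtains y z a d where "y \<in> univ N" "z \<in> univ N" "in_FU N Y y" "in_FU N Y z"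
    "elts V y = {a}" "elts V z = {a, d}" "a \<noteq> d"
proof -
  let ?A = "elts V (atoms V)"
  have Yu: "Y \<in> univ V" using Y(1) by (rule univ_N_subset)
  have Ys: "is_set V Y" using Y(2) by (simp add: is_infinite_def)
  have "is_symmetric V Y"
    using Y(1) Yu in_trans_closure_refl by (auto simp: univ_N hereditarily_symmetric_def)
  then obtain E where E: "E \<in> univ V" "is_subset V E (atoms V)" "is_finite V E"
    "pointwise_stabilizer V E \<subseteq> stabilizer V Y"
    unfolding is_symmetric_def by blast
  have "\<exists>y\<in>elts V Y. \<not> elts V y \<subseteq> elts V E"
  proof (rule ccontr)
    assume "\<not> (\<exists>y\<in>elts V Y. \<not> elts V y \<subseteq> elts V E)"
    then have s: "is_set V y \<and> elts V y \<subseteq> elts V E" if "y \<in> elts V Y" for y using sub that by blast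
    \<comment> \<open>Disjointness makes \<open>Y\<close> finite in \<open>V\<close>; as
      \<open>Y\<close> lies two power-set steps above the elements of \<open>E\<close>, it is then
      finite in the model too.\<close>
    have fin: "is_finite V Y" using finite_disjoint_family[OF E(1,3) Yu Ys s disj] by blast
    have "elts V Y \<subseteq> level (elts V E) 1" using s elts_univD[of _ V Y] by auto
    then have "Y \<in> level (elts V E) (Suc 1)" by (rule level_SucI[OF Yu Ys])
    then have "is_finite N Y" using finite_subset_in_N(2)[OF E(1-3) _ fin] by blast
    then show False using Y(2) by (simp add: is_infinite_def)
  qed
  then obtain y a where y: "y \<in> elts V Y" "a \<in> elts V y" "a \<notin> elts V E" by blast
  have yu: "y \<in> univ V" using y(1) by (rule elts_univD)
  have yA: "is_set V y" "elts V y \<subseteq> ?A" "is_finite V y" using sub[OF y(1)] by auto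
  have a: "a \<in> ?A" using y(2) yA(2) by blast
  have au: "a \<in> univ V" using a by (rule elts_univD)
  \<comment> \<open>\<open>d\<close> avoids \<open>E\<close> so that the transposition fixes
    \<open>E\<close> pointwise, and avoids \<open>y\<close> so that it moves
    \<open>y\<close>.\<close>
  obtain d where d: "d \<in> ?A" "d \<notin> elts V E" "d \<notin> elts V y"
    using fresh_atom[OF cinf E(1,3) yu yA(3)] .
  have du: "d \<in> univ V" using d(1) by (rule elts_univD)
  have ad: "a \<noteq> d" using d(3) y(2) by blast
  obtain \<pi> where p: "\<pi> \<in> atom_perms V"
    "\<And>u v. u \<in> univ V \<Longrightarrow> v \<in> univ V \<Longrightarrow> maps_to V \<pi> u v \<longleftrightarrow> u \<in> ?A \<and>
       v = (if u = a then d else if u = d then a else u)"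
    by (rule ex_transposition[OF a d(1)]) blast
  have "\<pi> \<in> pointwise_stabilizer V E"
    using p E(2) y(3) d(2) by (auto simp: pointwise_stabilizer_def is_subset_iff elts_def)
  then have "perm_image V \<pi> Y Y" using E(4) by (auto simp: stabilizer_def)
  then obtain y' where y': "y' \<in> elts V Y" "is_set V y'"
    "\<And>v. v \<in> elts V y' \<longleftrightarrow> v \<in> univ V \<and> (\<exists>u\<in>elts V y. maps_to V \<pi> u v)"
    using perm_image_mem[OF p(1) _ Yu y(1) yA(1,2)] by metis
  define s where "s u = (if u = a then d else if u = d then a else u)" for u
  have ey': "elts V y' = s ` elts V y"
  proof -
    have "v \<in> elts V y' \<longleftrightarrow> v \<in> s ` elts V y" for v
    proof (cases "v \<in> univ V")
      case True
      have "(\<exists>u\<in>elts V y. maps_to V \<pi> u v) \<longleftrightarrow> (\<exists>u\<in>elts V y. v = s u)"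
        using p(2)[OF elts_univD True] yA(2) unfolding s_def by (intro bex_cong) auto
      then show ?thesis using y'(3) True by (simp add: image_iff)
    next
      case False
      then show ?thesis using y'(3)[of v] au du elts_univD[of _ V y] by (auto simp: s_def)
    qed
    then show ?thesis by blast
  qed
  have "d \<in> elts V y'" using y(2) unfolding ey' by (auto simp: s_def)
  then have ne: "y \<noteq> y'" using d(3) by blast
  have ey: "elts V y = {a}"
  proof (rule ccontr)
    assume "elts V y \<noteq> {a}"
    \<comment> \<open>Such a \<open>b\<close> is fixed by the transposition and would lie in both
      \<open>y\<close> and \<open>y'\<close>.\<close>
    then obtain b where b: "b \<in> elts V y" "b \<noteq> a" using y(2) by blast
    then have "b \<noteq> d" using d(3) by blast
    then have "b \<in> elts V y'" using b unfolding ey' by (intro image_eqI[of _ _ b]) (auto simp: s_def)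
    then show False using disj[OF y(1) y'(1) ne] b(1) by blast
  qed
  have ey'': "elts V y' = {d}" unfolding ey' ey by (simp add: s_def)
  have y'u: "y' \<in> univ V" using y'(1) by (rule elts_univD)
  obtain z where z: "z \<in> univ V" "is_set V z" "elts V z = {a, d}" using ex_pair[OF au du] .
  obtain F1 where F1: "F1 \<in> univ V" "is_set V F1" "elts V F1 = {y, y}" using ex_pair[OF yu yu] .
  obtain F2 where F2: "F2 \<in> univ V" "is_set V F2" "elts V F2 = {y, y'}" using ex_pair[OF yu y'u] .
  have zf: "is_subset V z (atoms V)" "is_finite V z"
    using z a d(1) atoms_set finite_pair[OF au du z(1,3)] by (auto simp: is_subset_iff)
  \<comment> \<open>The set \<open>z\<close> of the two atoms is a common support of all witnesses:
    \<open>y\<close>, \<open>y'\<close> and \<open>z\<close> are on level 1 above it, the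
    subfamilies on level 2.\<close>
  have lv: "y \<in> level (elts V z) 1" "y' \<in> level (elts V z) 1" "z \<in> level (elts V z) 1"
    using yu y'u yA(1) y'(2) ey ey'' z by auto
  have lF: "F1 \<in> level (elts V z) (Suc 1)" "F2 \<in> level (elts V z) (Suc 1)"
    using lv F1 F2 by (intro level_SucI, simp_all del: level.simps)+
  note inN = finite_subset_in_N(1)[OF z(1) zf, THEN subsetD]
  note finN = finite_subset_in_N(2)[OF z(1) zf]
  have N: "y \<in> univ N" "z \<in> univ N" "F1 \<in> univ N" "F2 \<in> univ N" "y' \<in> univ N"
    using inN[OF lv(1)] inN[OF lv(3)] inN[OF lF(1)] inN[OF lF(2)] inN[OF lv(2)] .
  have "in_FU N Y y"
    unfolding in_FU_def
  proof (rule bexI[of _ F1], intro conjI)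
    show "is_subset N F1 Y" using F1 Y(1) Ys N y(1) by (simp add: is_subset_iff)
    show "is_finite N F1" using finN[OF lF(1) finite_pair[OF yu yu F1(1,3)]] .
    show "\<exists>w\<in>univ N. w \<epsilon>\<^bsub>N\<^esub> F1" using F1 yu N by (intro bexI[of _ y]) (simp_all add: mem_elts_iff)
    show "is_union N F1 y" using F1 N yA(1) by (simp add: is_union_iff)
  qed (use N in auto)
  moreover have "in_FU N Y z"
    unfolding in_FU_def
  proof (rule bexI[of _ F2], intro conjI)
    show "is_subset N F2 Y" using F2 Y(1) Ys N y(1) y'(1) by (simp add: is_subset_iff)
    show "is_finite N F2" using finN[OF lF(2) finite_pair[OF yu y'u F2(1,3)]] .
    show "\<exists>w\<in>univ N. w \<epsilon>\<^bsub>N\<^esub> F2" using F2 yu N by (intro bexI[of _ y]) (simp_all add: mem_elts_iff)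
    show "is_union N F2 z" using F2 N z ey ey'' by (auto simp: is_union_iff)
  qed (use N in auto)
  ultimately show thesis using that N(1,2) ey z(3) ad by blast
qed

end

theorem theorem3p5:
  fixes V :: "'u zfa_structure"
  assumes "zfac_model V"
    and "is_countably_infinite V (atoms V)"
  shows "\<not> HT (first_fraenkel_model V)"
proof
  interpret zfac_model V by fact
  assume HT: "HT N"
  obtain P where P: "P \<in> univ N" "is_set V P" "is_fin_subsets N (atoms V) P"
    "elts V P = {y \<in> univ V. is_set V y \<and> elts V y \<subseteq> elts V (atoms V) \<and> is_finite V y}"
    using ex_fin_subsets .
  obtain one two c where c: "two \<in> univ N" "is_two N two" "c \<in> univ N" "is_function N c P two"
    "\<And>y i. y \<in> univ V \<Longrightarrow> i \<in> univ V \<Longrightarrow> maps_to V c y i \<Longrightarrow> i = one \<longleftrightarrow> (\<exists>a. elts V y = {a})"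
    by (rule ex_colouring[OF P(1,2,4)]) blast
  \<comment> \<open>Otherwise there would be an atom outside the set of all atoms.\<close>
  have "\<not> is_finite V (atoms V)"
    using fresh_atom[OF assms(2) atoms_in_univ _ atoms_in_univ] by blast
  then have "is_infinite N (atoms V)"
    using finite_if_finite_N[OF atoms_in_N] atoms_set by (auto simp: is_infinite_def)
  then obtain Y i where Y: "Y \<in> univ N" "is_subset N Y P" "is_infinite N Y"
    and disj: "\<forall>y\<in>univ N. \<forall>y'\<in>univ N. y \<epsilon>\<^bsub>N\<^esub> Y \<and> y' \<epsilon>\<^bsub>N\<^esub> Y \<and> y \<noteq> y' \<longrightarrow> disjoint_in N y y'"
    and i: "i \<in> univ N" "\<forall>z\<in>univ N. in_FU N Y z \<longrightarrow> maps_to N c z i"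
    using HT[unfolded HT_def, rule_format, OF atoms_in_N P(1) c(1,3)] P(3) c(2,4) by blast
  have "elts V Y \<subseteq> elts V P" using Y(1,2) P(1) by (simp add: is_subset_iff)
  then have sub: "is_set V y \<and> elts V y \<subseteq> elts V (atoms V) \<and> is_finite V y" if "y \<in> elts V Y" for y
    using that unfolding P(4) by blast
  have dj: "elts V y \<inter> elts V y' = {}" if "y \<in> elts V Y" "y' \<in> elts V Y" "y \<noteq> y'" for y y'
  proof -
    have "y \<in> univ N" "y' \<in> univ N" using univ_N_transitive[OF Y(1)] that by auto
    moreover from this have "disjoint_in N y y'" using disj that by (auto simp: elts_def)
    ultimately show ?thesis by (simp add: disjoint_in_iff)
  qed
  obtain y z a d where yz: "y \<in> univ N" "z \<in> univ N" "in_FU N Y y" "in_FU N Y z"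
    "elts V y = {a}" "elts V z = {a, d}" "a \<noteq> d"
    using infinite_family_FU[OF assms(2) Y(1,3) sub dj] .
  have "maps_to V c y i" "maps_to V c z i" using i yz c(3) by (auto simp: maps_to_N)
  \<comment> \<open>The singleton \<open>y\<close> forces \<open>i = one\<close>, and the same
    colour then forces \<open>z\<close> to be a singleton, against
    \<open>a \<noteq> d\<close>.\<close>
  then have "(\<exists>a. elts V z = {a})"
    using c(5)[of y i] c(5)[of z i] yz(1,2,5) i(1) univ_N_subset by auto
  then show False using yz(6,7) by auto
qed

end
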